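(* For any pair of positive integers $m$ and $k$, $$\lim_{n\rightarrow\infty}\left(\mathrm{avoid}^{(m,1^{k-1})}_n\right)^{1/2n}=\max\{m-1,k-1\}.$$
   Context: The hook $(m,1^{k-1})$ is the partition with first part $m$ followed by $k-1$ parts equal to $1$. The shape of a permutation is the common shape (a partition) of the two standard Young tableaux associated to it by the Robinson-Schensted(-Knuth) correspondence (by row insertion). A permutation $\pi=(\pi_1,\dots,\pi_n)\in S_n$ avoids a permutation $\sigma=(\sigma_1,\dots,\sigma_r)\in S_r$ if there is no subsequence $(\pi_{i_1},\dots,\pi_{i_r})$, $i_1<\dots<i_r$, of $\pi$ such that for all $j,l$: $\pi_{i_j}>\pi_{i_l}$ iff $\sigma_j>\sigma_l$. For a partition $\mu$ of $r$, $\pi$ is $\mu$-avoiding if it avoids all permutations in $S_r$ of shape $\mu$. $\mathrm{avoid}_n^\mu$ denotes the number of $\mu$-avoiding permutations in $S_n$. The exponent $1/2n$ means $1/(2n)$. *)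

theory Defs
  imports
    Complex_Main
    "HOL-Library.Sublist"
    "HOL-Combinatorics.Multiset_Permutations"
begin

text \<open>
  Permutations in \<open>S\<^sub>n\<close> are given in one-line notation, as the elements of
  \<open>permutations_of_set {1..n}\<close>. Tableaux are lists of rows, the first row being the head;
  partitions are weakly decreasing lists of positive parts.
\<close>

text \<open>The second component is the entry bumped out of the row, if any.\<close>

fun row_insert :: "nat \<Rightarrow> nat list \<Rightarrow> nat list \<times> nat option" where
  "row_insert x [] = ([x], None)"
| "row_insert x (y # ys) =
    (if x < y then (x # ys, Some y)
     else (case row_insert x ys of (zs, b) \<Rightarrow> (y # zs, b)))"

text \<open>The second component is the (0-based) index of the row in which the new cell appears.\<close>

fun tableau_insert :: "nat \<Rightarrow> nat list list \<Rightarrow> nat list list \<times> nat" where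
  "tableau_insert x [] = ([[x]], 0)"
| "tableau_insert x (r # rs) =
    (case row_insert x r of
       (r', None) \<Rightarrow> (r' # rs, 0)
     | (r', Some y) \<Rightarrow> (case tableau_insert y rs of (rs', i) \<Rightarrow> (r' # rs', Suc i)))"

definition add_cell :: "nat \<Rightarrow> nat \<Rightarrow> nat list list \<Rightarrow> nat list list" where
  "add_cell t i Q = (if i < length Q then Q[i := Q ! i @ [t]] else Q @ [[t]])"

text \<open>
  \<open>rs_from t w (P, Q)\<close> inserts the letters of \<open>w\<close> into \<open>P\<close> one after the other, recording
  the new cells in \<open>Q\<close> by the labels \<open>t, t + 1, \<dots>\<close>.
\<close>

fun rs_from :: "nat \<Rightarrow> nat list \<Rightarrow> nat list list \<times> nat list list \<Rightarrow>
    nat list list \<times> nat list list" where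
  "rs_from t [] (P, Q) = (P, Q)"
| "rs_from t (x # w) (P, Q) =
    (case tableau_insert x P of (P', i) \<Rightarrow> rs_from (Suc t) w (P', add_cell t i Q))"

definition robinson_schensted :: "nat list \<Rightarrow> nat list list \<times> nat list list" where
  "robinson_schensted w = rs_from 1 w ([], [])"

definition tableau_shape :: "nat list list \<Rightarrow> nat list" where
  "tableau_shape T = map length T"

definition rs_shape :: "nat list \<Rightarrow> nat list" where
  "rs_shape w = tableau_shape (fst (robinson_schensted w))"

lemma row_insert_length:
  "length (fst (row_insert x r)) =
    (case snd (row_insert x r) of None \<Rightarrow> Suc (length r) | Some _ \<Rightarrow> length r)"
  by (induction r) (auto split: prod.splits option.splits)

lemma tableau_shape_insert:
  assumes "tableau_shape P = tableau_shape Q" and "tableau_insert x P = (P', i)"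
  shows "tableau_shape P' = tableau_shape (add_cell t i Q)"
  using assms
proof (induction P arbitrary: x Q P' i)
  case Nil
  then show ?case by (auto simp: tableau_shape_def add_cell_def)
next
  case (Cons r P)
  obtain q Q' where Q: "Q = q # Q'" and len: "length q = length r"
    and sh: "tableau_shape P = tableau_shape Q'"
    using Cons.prems(1) by (cases Q) (auto simp: tableau_shape_def)
  obtain r' b where ri: "row_insert x r = (r', b)" by (cases "row_insert x r")
  show ?case
  proof (cases b)
    case None
    then show ?thesis
      using Cons.prems(2) ri Q len sh row_insert_length[of x r]
      by (auto simp: tableau_shape_def add_cell_def)
  next
    case (Some y)
    obtain P'' j where ti: "tableau_insert y P = (P'', j)" by (cases "tableau_insert y P")
    have "tableau_shape P'' = tableau_shape (add_cell t j Q')"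
      by (rule Cons.IH[OF sh ti])
    then show ?thesis
      using Cons.prems(2) ri Some ti Q len row_insert_length[of x r]
      by (auto simp: tableau_shape_def add_cell_def split: if_splits)
  qed
qed

lemma rs_shape_common:
  "rs_shape w = tableau_shape (snd (robinson_schensted w))"
proof -
  have "tableau_shape (fst (rs_from t w (P, Q))) = tableau_shape (snd (rs_from t w (P, Q)))"
    if "tableau_shape P = tableau_shape Q" for t P Q
    using that
    by (induction w arbitrary: t P Q) (auto split: prod.splits dest: tableau_shape_insert)
  then show ?thesis
    by (simp add: rs_shape_def robinson_schensted_def)
qed

definition avoids :: "nat list \<Rightarrow> nat list \<Rightarrow> bool" where
  "avoids p s \<longleftrightarrow>
    \<not> (\<exists>q. subseq q p \<and> length q = length s \<and>
         (\<forall>j < length s. \<forall>l < length s. q ! j > q ! l \<longleftrightarrow> s ! j > s ! l))"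

definition shape_avoiding :: "nat list \<Rightarrow> nat list \<Rightarrow> bool" where
  "shape_avoiding \<mu> p \<longleftrightarrow>
    (\<forall>s \<in> permutations_of_set {1..sum_list \<mu>}. rs_shape s = \<mu> \<longrightarrow> avoids p s)"

definition avoid_count :: "nat list \<Rightarrow> nat \<Rightarrow> nat" where
  "avoid_count \<mu> n = card {p \<in> permutations_of_set {1..n}. shape_avoiding \<mu> p}"

definition hook :: "nat \<Rightarrow> nat \<Rightarrow> nat list" where
  "hook m k = m # replicate (k - 1) 1"

end

theory Submission imports Defs "HOL-Real_Asymp.Real_Asymp" begin

text \<open>
  By Schensted's theorem, a permutation contains a pattern of shape \<open>(m, 1\<^sup>k\<^sup>-\<^sup>1)\<close> iff some entry lies
  both in an increasing subsequence of length \<open>m\<close> and in a decreasing one of length \<open>k\<close>.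

  Upper bound: let \<open>A\<close> be the set of entries of an avoiding permutation in no increasing subsequence of
  length \<open>m\<close>; the entries of the complement \<open>B\<close> are in no decreasing one of length \<open>k\<close>. If both were
  large, then by Erdos-Szekeres \<open>A\<close> would contain a long decreasing and \<open>B\<close> a long increasing
  sequence, and counting the ascents and descents between the two gives a contradiction. So up to
  boundedly many entries the permutation is a union of \<open>m - 1\<close> decreasing or \<open>k - 1\<close> increasing
  sequences, and it is determined by the colours of its positions and of its values.

  Lower bound: a permutation without increasing subsequences of length \<open>d + 1\<close> avoids the hook with
  \<open>m = d + 1\<close>. Many of them arise from two words in \<open>d\<close> letters with the same content, which
  colour the positions and the values. Words built from blocks of a fixed content, of which there
  are almost \<open>d\<^sup>N\<close> for block length \<open>N\<close>, can be arranged so that the permutation determines them.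
\<close>

section \<open>Schensted's theorem for rows and columns\<close>

definition has_chain :: "(nat \<Rightarrow> nat \<Rightarrow> bool) \<Rightarrow> nat \<Rightarrow> nat list \<Rightarrow> bool" where
  "has_chain R j w \<longleftrightarrow> (\<exists>c. subseq c w \<and> sorted_wrt R c \<and> length c = j)"

lemma subseq_snoc_iff:
  "subseq c (w @ [x]) \<longleftrightarrow> subseq c w \<or> (\<exists>c'. c = c' @ [x] \<and> subseq c' w)"
proof
  assume "subseq c (w @ [x])"
  then obtain c1 c2 where c: "c = c1 @ c2" "subseq c1 w" "subseq c2 [x]"
    by (auto simp: subseq_append_iff)
  from c(3) have "c2 = [] \<or> c2 = [x]"
    by (metis list_emb_Nil2 subseq_Cons2_iff neq_Nil_conv)
  then show "subseq c w \<or> (\<exists>c'. c = c' @ [x] \<and> subseq c' w)"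
    using c by auto
next
  assume "subseq c w \<or> (\<exists>c'. c = c' @ [x] \<and> subseq c' w)"
  then show "subseq c (w @ [x])"
    by (auto simp: subseq_append_iff intro: exI[of _ "[]"])
qed

text \<open>\<open>row_pass w r b\<close>: inserting the letters of \<open>w\<close> leaves \<open>r\<close> in the first row, and \<open>b\<close> is the
  word of letters passed on to the second row.\<close>

inductive row_pass :: "nat list \<Rightarrow> nat list \<Rightarrow> nat list \<Rightarrow> bool" where
  empty: "row_pass [] [] []"
| extend: "row_pass w r b \<Longrightarrow> x \<notin> set w \<Longrightarrow> (\<And>y. y \<in> set r \<Longrightarrow> y < x)
    \<Longrightarrow> row_pass (w @ [x]) (r @ [x]) b"
| bump: "row_pass w (r1 @ e # r2) b \<Longrightarrow> x \<notin> set w \<Longrightarrow> (\<And>y. y \<in> set r1 \<Longrightarrow> y < x)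
    \<Longrightarrow> x < e \<Longrightarrow> row_pass (w @ [x]) (r1 @ x # r2) (b @ [e])"

lemma row_pass_mset: "row_pass w r b \<Longrightarrow> mset w = mset r + mset b"
  by (induction rule: row_pass.induct) auto

lemma row_pass_set: "row_pass w r b \<Longrightarrow> set w = set r \<union> set b"
  by (metis row_pass_mset set_mset_mset set_mset_union)

lemma row_pass_sorted: "row_pass w r b \<Longrightarrow> sorted_wrt (<) r"
  by (induction rule: row_pass.induct) (fastforce simp: sorted_wrt_append)+

text \<open>Written as a left fold, so that passing from \<open>w\<close> to \<open>w @ [x]\<close>
  is a single insertion, as inductions from the right require.\<close>

definition insertion_tableau :: "nat list \<Rightarrow> nat list list" where
  "insertion_tableau w = foldl (\<lambda>P x. fst (tableau_insert x P)) [] w"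

lemma rs_from_fst: "fst (rs_from t w (P, Q)) = foldl (\<lambda>P x. fst (tableau_insert x P)) P w"
  by (induction w arbitrary: t P Q) (auto split: prod.splits)

lemma rs_shape_eq: "rs_shape w = map length (insertion_tableau w)"
  by (simp add: rs_shape_def robinson_schensted_def insertion_tableau_def rs_from_fst
      tableau_shape_def)

lemma row_insert_None:
  "row_insert x r = (r', None) \<Longrightarrow> x \<notin> set r \<Longrightarrow> r' = r @ [x] \<and> (\<forall>y\<in>set r. y < x)"
  by (induction r arbitrary: r') (auto split: if_splits prod.splits)

lemma row_insert_Some:
  "row_insert x r = (r', Some e) \<Longrightarrow> x \<notin> set r \<Longrightarrow>
    \<exists>r1 r2. r = r1 @ e # r2 \<and> r' = r1 @ x # r2 \<and> x < e \<and> (\<forall>y\<in>set r1. y < x)"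
proof (induction r arbitrary: r')
  case (Cons y ys)
  show ?case
  proof (cases "x < y")
    case True
    with Cons.prems show ?thesis by (intro exI[of _ "[]"] exI[of _ ys]) auto
  next
    case False
    with Cons.prems obtain zs where zs: "row_insert x ys = (zs, Some e)" "r' = y # zs"
      by (auto split: prod.splits)
    from Cons.IH[OF zs(1)] Cons.prems obtain r1 r2 where
      "ys = r1 @ e # r2 \<and> zs = r1 @ x # r2 \<and> x < e \<and> (\<forall>y\<in>set r1. y < x)"
      by auto
    with False Cons.prems zs show ?thesis
      by (intro exI[of _ "y # r1"] exI[of _ r2]) auto
  qed
qed simp

text \<open>The second row receives the bumped letters in the order of bumping, so the rows below
  the first form the insertion tableau of \<open>b\<close>. Later inductions peel off one row at a
  time in this way.\<close>

lemma row_pass_exists: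
  assumes "distinct w" "w \<noteq> []"
  shows "\<exists>r b. row_pass w r b \<and> insertion_tableau w = r # insertion_tableau b"
  using assms
proof (induction w rule: rev_induct)
  case (snoc x w)
  show ?case
  proof (cases "w = []")
    case True
    then show ?thesis using row_pass.extend[OF row_pass.empty, of x]
      by (intro exI[of _ "[x]"] exI[of _ "[]"]) (auto simp: insertion_tableau_def)
  next
    case False
    with snoc obtain r b where rb: "row_pass w r b"
      "insertion_tableau w = r # insertion_tableau b" by auto
    have T: "insertion_tableau (w @ [x]) = fst (tableau_insert x (r # insertion_tableau b))"
      using rb(2) by (simp add: insertion_tableau_def)
    have x: "x \<notin> set w" "x \<notin> set r" using snoc.prems row_pass_set[OF rb(1)] by auto
    obtain r' o' where ri: "row_insert x r = (r', o')" by fastforce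
    show ?thesis
    proof (cases o')
      case None
      then have "r' = r @ [x]" "\<forall>y\<in>set r. y < x" using row_insert_None ri x by auto
      then have "row_pass (w @ [x]) r' b" using row_pass.extend[OF rb(1) x(1)] by auto
      moreover have "insertion_tableau (w @ [x]) = r' # insertion_tableau b"
        using T ri None by simp
      ultimately show ?thesis by blast
    next
      case (Some e)
      obtain r1 r2 where r: "r = r1 @ e # r2 \<and> r' = r1 @ x # r2 \<and> x < e \<and> (\<forall>y\<in>set r1. y < x)"
        using row_insert_Some ri x(2) unfolding Some by blast
      have "row_pass (w @ [x]) r' (b @ [e])" using row_pass.bump[of w r1 e r2 b x] rb(1) x(1) r
        by auto
      moreover have "insertion_tableau (w @ [x]) = r' # insertion_tableau (b @ [e])"
        using T ri Some by (auto simp: insertion_tableau_def split: prod.splits)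
      ultimately show ?thesis by blast
    qed
  qed
qed simp

section \<open>Increasing subsequences and the first row\<close>

text \<open>When a letter enters the row, its left neighbour is smaller and already ends an
  increasing subsequence that is shorter by one. That subsequence extends by the new letter.\<close>

lemma row_pass_increasing_exists:
  assumes "row_pass w r b" "i < length r"
  shows "\<exists>c. subseq (c @ [r ! i]) w \<and> sorted_wrt (<) (c @ [r ! i]) \<and> length c = i"
  using assms
proof (induction arbitrary: i rule: row_pass.induct)
  case empty
  then show ?case by simp
next
  case (extend w r b x)
  have old: "\<exists>c. subseq (c @ [r ! i]) (w @ [x]) \<and> sorted_wrt (<) (c @ [r ! i]) \<and> length c = i"
    if "i < length r" for i
    using extend.IH[OF that] by (blast intro: subseq_rev_drop_many)
  show ?case
  proof (cases "i < length r")
    case True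
    then show ?thesis using old[OF True] by (simp add: nth_append)
  next
    case False
    then have i: "i = length r" using extend.prems by simp
    show ?thesis
    proof (cases "r = []")
      case True
      then show ?thesis using i by (intro exI[of _ "[]"]) (auto simp: subseq_snoc_iff)
    next
      case False
      then obtain c where c: "subseq (c @ [r ! (i - 1)]) w" "sorted_wrt (<) (c @ [r ! (i - 1)])"
        "length c = i - 1"
        using extend.IH[of "i - 1"] i by auto
      have "r ! (i - 1) < x" using extend.hyps(3) False i by simp
      with c(2) have "sorted_wrt (<) ((c @ [r ! (i - 1)]) @ [x])"
        by (auto simp: sorted_wrt_append intro: less_trans)
      moreover have "subseq ((c @ [r ! (i - 1)]) @ [x]) (w @ [x])" using c(1)
        by (simp only: subseq_append)
      ultimately show ?thesis using c(3) i False
        by (intro exI[of _ "c @ [r ! (i - 1)]"]) (auto simp: nth_append)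
    qed
  qed
next
  case (bump w r1 e r2 b x)
  let ?r = "r1 @ e # r2"
  show ?case
  proof (cases "i = length r1")
    case False
    then have eq: "(r1 @ x # r2) ! i = ?r ! i"
      by (simp add: nth_append nth_Cons' )
    show ?thesis unfolding eq using bump.IH[of i] bump.prems by (auto simp: subseq_snoc_iff)
  next
    case True
    show ?thesis
    proof (cases "i = 0")
      case True
      with \<open>i = length r1\<close> show ?thesis
        by (intro exI[of _ "[]"]) (auto simp: subseq_snoc_iff)
    next
      case False
      then have "i - 1 < length r1" using True by simp
      then obtain c where c: "subseq (c @ [r1 ! (i - 1)]) w" "sorted_wrt (<) (c @ [r1 ! (i - 1)])"
        "length c = i - 1"
        using bump.IH[of "i - 1"] by (auto simp: nth_append)
      have "r1 ! (i - 1) < x" using bump.hyps(3) False True by simp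
      with c(2) have "sorted_wrt (<) ((c @ [r1 ! (i - 1)]) @ [x])"
        by (auto simp: sorted_wrt_append intro: less_trans)
      moreover have "subseq ((c @ [r1 ! (i - 1)]) @ [x]) (w @ [x])" using c(1)
        by (simp only: subseq_append)
      ultimately show ?thesis using c(3) True False
        by (intro exI[of _ "c @ [r1 ! (i - 1)]"]) auto
    qed
  qed
qed

text \<open>With the preceding lemma this characterizes \<open>r ! i\<close> as the least letter
  ending an increasing subsequence of length \<open>i + 1\<close>. The bound persists because an
  entry of the row is only ever replaced by a smaller one.\<close>

lemma row_pass_increasing_bound:
  assumes "row_pass w r b" "subseq (c @ [z]) w" "sorted_wrt (<) (c @ [z])"
  shows "length c < length r \<and> r ! length c \<le> z"
  using assms
proof (induction arbitrary: c z rule: row_pass.induct)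
  case empty
  then show ?case by simp
next
  case (extend w r b x)
  from extend.prems(1) consider "subseq (c @ [z]) w" | "z = x" "subseq c w"
    by (auto simp: subseq_snoc_iff)
  then show ?case
  proof cases
    case 1
    from extend.IH[OF 1 extend.prems(2)] show ?thesis by (auto simp: nth_append)
  next
    case 2
    have "length c \<le> length r"
    proof (cases c rule: rev_cases)
      case (snoc c' y)
      then show ?thesis using extend.IH[of c' y] 2 extend.prems(2)
        by (auto simp: sorted_wrt_append)
    qed simp
    then show ?thesis using 2 extend.hyps(3)[of "r ! length c"]
      by (cases "length c = length r") (auto simp: nth_append less_imp_le)
  qed
next
  case (bump w r1 e r2 b x)
  let ?r = "r1 @ e # r2"
  have le: "(r1 @ x # r2) ! i \<le> ?r ! i" for i
    using bump.hyps(4) by (auto simp: nth_append nth_Cons')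
  from bump.prems(1) consider "subseq (c @ [z]) w" | "z = x" "subseq c w"
    by (auto simp: subseq_snoc_iff)
  then show ?case
  proof cases
    case 1
    from bump.IH[OF 1 bump.prems(2)] le[of "length c"] show ?thesis by auto
  next
    case 2
    have "length c \<le> length r1"
    proof (cases c rule: rev_cases)
      case (snoc c' y)
      then have *: "length c' < length ?r" "?r ! length c' \<le> y" "y < x"
        using bump.IH[of c' y] 2 bump.prems(2) by (auto simp: sorted_wrt_append)
      \<comment> \<open>Otherwise the bound for \<open>y\<close> would give
        \<open>e \<le> y\<close>, whereas \<open>y < x < e\<close>.\<close>
      have "length c' < length r1"
      proof (rule ccontr)
        assume ge: "\<not> length c' < length r1"
        have "e \<le> ?r ! length c'"
        proof (cases "length c' = length r1")
          case False
          then have "?r ! length r1 < ?r ! length c'"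
            using sorted_wrt_nth_less[OF row_pass_sorted[OF bump.hyps(1)], of "length r1" "length c'"]
              ge *(1) by auto
          then show ?thesis by simp
        qed simp
        with * bump.hyps(4) show False by simp
      qed
      then show ?thesis using snoc by simp
    qed simp
    then show ?thesis using 2 bump.hyps(3)[of "r1 ! length c"]
      by (cases "length c = length r1") (auto simp: nth_append less_imp_le)
  qed
qed

text \<open>The next two lemmas are invariants showing that the longest decreasing subsequence of \<open>w\<close> is one
  longer than that of \<open>b\<close>; by induction, its length is the number of rows.\<close>

lemma row_pass_decreasing_down:
  assumes "row_pass w r b" "subseq (c @ [x]) w" "sorted_wrt (>) (c @ [x])"
  shows "(x \<in> set r \<and> (\<exists>s. subseq s b \<and> sorted_wrt (>) (s @ [x]) \<and> length s = length c)) \<or>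
    (\<exists>s. subseq s b \<and> sorted_wrt (>) s \<and> (\<forall>y\<in>set s. x \<le> y) \<and> length s = Suc (length c))"
  using assms
proof (induction arbitrary: c x rule: row_pass.induct)
  case empty
  then show ?case by simp
next
  case (extend w r b z)
  from extend.prems(1) consider "subseq (c @ [x]) w" | "x = z" "subseq c w"
    by (auto simp: subseq_snoc_iff)
  then show ?case
  proof cases
    case 1
    from extend.IH[OF 1 extend.prems(2)] show ?thesis by auto
  next
    case 2
    show ?thesis
    proof (cases c rule: rev_cases)
      case Nil
      then show ?thesis using 2 by (intro disjI1 conjI exI[of _ "[]"]) auto
    next
      case (snoc c' y)
      then have "subseq (c' @ [y]) w" "sorted_wrt (>) (c' @ [y])" "x < y"
        using 2 extend.prems(2) by (auto simp: sorted_wrt_append)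
      from extend.IH[OF this(1,2)] show ?thesis
      proof
        assume "y \<in> set r \<and> (\<exists>s. subseq s b \<and> sorted_wrt (>) (s @ [y]) \<and> length s = length c')"
        with extend.hyps(3) \<open>x < y\<close> 2 show ?thesis by fastforce
      next
        assume "\<exists>s. subseq s b \<and> sorted_wrt (>) s \<and> (\<forall>z\<in>set s. y \<le> z) \<and> length s = Suc (length c')"
        with \<open>x < y\<close> 2 snoc show ?thesis by (intro disjI1) (fastforce simp: sorted_wrt_append)
      qed
    qed
  qed
next
  case (bump w r1 e r2 b z)
  have srt: "sorted_wrt (<) (r1 @ e # r2)" using row_pass_sorted[OF bump.hyps(1)] .
  from bump.prems(1) consider "subseq (c @ [x]) w" | "x = z" "subseq c w"
    by (auto simp: subseq_snoc_iff)
  then show ?case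
  proof cases
    case 1
    from bump.IH[OF 1 bump.prems(2)] show ?thesis
    proof
      assume *: "x \<in> set (r1 @ e # r2) \<and>
        (\<exists>s. subseq s b \<and> sorted_wrt (>) (s @ [x]) \<and> length s = length c)"
      then obtain s where s: "subseq s b" "sorted_wrt (>) (s @ [x])" "length s = length c" by auto
      \<comment> \<open>If the chain ends in the bumped letter, that letter leaves the row and
        lengthens the chain in \<open>b\<close>.\<close>
      show ?thesis
      proof (cases "x = e")
        case True
        then show ?thesis using s
          by (intro disjI2 exI[of _ "s @ [e]"])
             (auto simp: subseq_snoc_iff sorted_wrt_append less_imp_le)
      next
        case False
        with * s show ?thesis by (intro disjI1) (auto simp: subseq_snoc_iff)
      qed
    next
      assume "\<exists>s. subseq s b \<and> sorted_wrt (>) s \<and> (\<forall>y\<in>set s. x \<le> y) \<and> length s = Suc (length c)"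
      then show ?thesis by (intro disjI2) (auto simp: subseq_snoc_iff)
    qed
  next
    case 2
    show ?thesis
    proof (cases c rule: rev_cases)
      case Nil
      then show ?thesis using 2 by (intro disjI1 conjI exI[of _ "[]"]) auto
    next
      case (snoc c' y)
      then have "subseq (c' @ [y]) w" "sorted_wrt (>) (c' @ [y])" "x < y"
        using 2 bump.prems(2) by (auto simp: sorted_wrt_append)
      from bump.IH[OF this(1,2)] show ?thesis
      proof
        assume *: "y \<in> set (r1 @ e # r2) \<and>
          (\<exists>s. subseq s b \<and> sorted_wrt (>) (s @ [y]) \<and> length s = length c')"
        then obtain s where s: "subseq s b" "sorted_wrt (>) (s @ [y])" "length s = length c'" by auto
        \<comment> \<open>Letters of \<open>r1\<close> lie below the inserted \<open>x\<close>, so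
          \<open>y\<close> stands at or after the bumped \<open>e\<close>. Hence \<open>e\<close>
          fits between \<open>s\<close> and \<open>x\<close>.\<close>
        have "y \<notin> set r1" using bump.hyps(3)[of y] 2 \<open>x < y\<close> by auto
        then have "e \<le> y" using * srt by (auto simp: sorted_wrt_append)
        then have "sorted_wrt (>) ((s @ [e]) @ [x])"
          using s bump.hyps(4) 2 by (fastforce simp: sorted_wrt_append)
        then show ?thesis using s 2 snoc
          by (intro disjI1 conjI exI[of _ "s @ [e]"]) (auto simp: subseq_snoc_iff)
      next
        assume "\<exists>s. subseq s b \<and> sorted_wrt (>) s \<and> (\<forall>z\<in>set s. y \<le> z) \<and> length s = Suc (length c')"
        then obtain s where "subseq s b" "sorted_wrt (>) s" "\<forall>z\<in>set s. y \<le> z"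
          "length s = Suc (length c')" by auto
        with \<open>x < y\<close> 2 snoc show ?thesis
          by (intro disjI1 conjI exI[of _ s]) (fastforce simp: sorted_wrt_append subseq_snoc_iff)+
      qed
    qed
  qed
qed

lemma row_pass_decreasing_up:
  assumes "row_pass w r b" "subseq s b"
  shows "(e \<in> set r \<longrightarrow> sorted_wrt (>) (s @ [e]) \<longrightarrow>
      (\<exists>c. subseq c w \<and> sorted_wrt (>) c \<and> (\<forall>y\<in>set c. e \<le> y) \<and> length c = Suc (length s))) \<and>
    (s \<noteq> [] \<longrightarrow> sorted_wrt (>) s \<longrightarrow>
      (\<exists>c. subseq c w \<and> sorted_wrt (>) c \<and> (\<forall>y\<in>set c. last s \<le> y) \<and> length c = length s))"
  using assms
proof (induction arbitrary: s e rule: row_pass.induct)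
  case empty
  then show ?case by simp
next
  case (extend w r b x)
  have new: "\<exists>c. subseq c (w @ [x]) \<and> sorted_wrt (>) c \<and> (\<forall>y\<in>set c. x \<le> y) \<and> length c = Suc (length s)"
    if s: "sorted_wrt (>) (s @ [x])"
  proof (cases "s = []")
    case True
    then show ?thesis by (intro exI[of _ "[x]"]) auto
  next
    case False
    with extend.IH[OF extend.prems, of x] s obtain c where "subseq c w" "sorted_wrt (>) c"
      "\<forall>y\<in>set c. last s \<le> y" "length c = length s" by (auto simp: sorted_wrt_append)
    moreover have "x < last s" using False s by (auto simp: sorted_wrt_append)
    ultimately show ?thesis
      by (intro exI[of _ "c @ [x]"])
           (auto simp: sorted_wrt_append intro: less_le_trans less_imp_le le_trans)
  qed
  show ?case using new extend.IH[OF extend.prems, of e] by (auto simp: subseq_snoc_iff)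
next
  case (bump w r1 e' r2 b x)
  have srt: "sorted_wrt (<) (r1 @ e' # r2)" using row_pass_sorted[OF bump.hyps(1)] .
  from bump.prems consider "subseq s b" | s' where "s = s' @ [e']" "subseq s' b"
    by (auto simp: subseq_snoc_iff)
  then show ?case
  proof cases
    case 1
    have new: "\<exists>c. subseq c (w @ [x]) \<and> sorted_wrt (>) c \<and> (\<forall>y\<in>set c. x \<le> y) \<and> length c = Suc (length s)"
      if s: "sorted_wrt (>) (s @ [x])"
    proof (cases "s = []")
      case True
      then show ?thesis by (intro exI[of _ "[x]"]) auto
    next
      case False
      with bump.IH[OF 1, of x] s obtain c where "subseq c w" "sorted_wrt (>) c"
        "\<forall>y\<in>set c. last s \<le> y" "length c = length s" by (auto simp: sorted_wrt_append)
      moreover have "x < last s" using False s by (auto simp: sorted_wrt_append)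
      ultimately show ?thesis
        by (intro exI[of _ "c @ [x]"])
           (auto simp: sorted_wrt_append intro: less_le_trans less_imp_le le_trans)
    qed
    show ?thesis using new bump.IH[OF 1, of e] by (auto simp: subseq_snoc_iff)
  next
    case 2
    show ?thesis
    proof (intro conjI impI)
      assume e: "e \<in> set (r1 @ x # r2)" "sorted_wrt (>) (s @ [e])"
      then have "e < e'" using 2 by (auto simp: sorted_wrt_append)
      \<comment> \<open>Letters of \<open>r2\<close> exceed \<open>e'\<close>, so \<open>e\<close>
        is \<open>x\<close> itself or belongs to \<open>r1\<close>.\<close>
      then have "e \<le> x" using e(1) srt bump.hyps(3)[of e] by (auto simp: sorted_wrt_append)
      have "sorted_wrt (>) (s' @ [e'])" using e 2 by (auto simp: sorted_wrt_append)
      with bump.IH[OF 2(2), of e'] obtain c where "subseq c w" "sorted_wrt (>) c"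
        "\<forall>y\<in>set c. e' \<le> y" "length c = Suc (length s')" by auto
      with \<open>e \<le> x\<close> bump.hyps(4) 2
      show "\<exists>c. subseq c (w @ [x]) \<and> sorted_wrt (>) c \<and> (\<forall>y\<in>set c. e \<le> y) \<and> length c = Suc (length s)"
        by (intro exI[of _ "c @ [x]"])
           (auto simp: sorted_wrt_append intro: less_le_trans less_imp_le le_trans)
    next
      assume "s \<noteq> []" "sorted_wrt (>) s"
      with bump.IH[OF 2(2), of e'] 2 show "\<exists>c. subseq c (w @ [x]) \<and> sorted_wrt (>) c \<and>
        (\<forall>y\<in>set c. last s \<le> y) \<and> length c = length s"
        by (auto simp: subseq_snoc_iff)
    qed
  qed
qed

text \<open>The letter that displaces \<open>y\<close> is smaller than \<open>y\<close>; it may be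
  displaced in turn, but only by a still smaller letter.\<close>

lemma row_pass_bumped_less: "row_pass w r b \<Longrightarrow> y \<in> set b \<Longrightarrow> \<exists>e\<in>set r. e < y"
  by (induction arbitrary: y rule: row_pass.induct) (fastforce dest: less_trans)+

lemma row_pass_length_less: "row_pass w r b \<Longrightarrow> w \<noteq> [] \<Longrightarrow> length b < length w"
proof -
  assume rp: "row_pass w r b" and "w \<noteq> []"
  from rp have "r \<noteq> [] \<or> w = []" by (cases rule: row_pass.cases) auto
  then show ?thesis using \<open>w \<noteq> []\<close> arg_cong[OF row_pass_mset[OF rp], of size] by simp
qed

section \<open>Length of the first row and number of rows of the insertion tableau\<close>

lemma insertion_tableau_first_row:
  assumes "distinct w" "w \<noteq> []"
  shows "has_chain (<) (length (hd (insertion_tableau w))) w"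
    and "has_chain (<) j w \<Longrightarrow> j \<le> length (hd (insertion_tableau w))"
proof -
  obtain r b where rb: "row_pass w r b" "insertion_tableau w = r # insertion_tableau b"
    using row_pass_exists[OF assms] by auto
  have "r \<noteq> []" using rb(1) assms(2) by (cases rule: row_pass.cases) auto
  then show "has_chain (<) (length (hd (insertion_tableau w))) w"
    using row_pass_increasing_exists[OF rb(1), of "length r - 1"] rb(2)
    unfolding has_chain_def by fastforce
  assume "has_chain (<) j w"
  then obtain c where c: "subseq c w" "sorted_wrt (<) c" "length c = j"
    by (auto simp: has_chain_def)
  show "j \<le> length (hd (insertion_tableau w))"
    using c row_pass_increasing_bound[OF rb(1), of "butlast c" "last c"] rb(2)
    by (cases c rule: rev_cases) auto
qed

text \<open>A decreasing subsequence of \<open>w\<close> loses at most one letter on passing to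
  \<open>b\<close>, while the tableau loses exactly one row.\<close>

lemma insertion_tableau_decreasing_le:
  assumes "distinct w" "has_chain (>) j w"
  shows "j \<le> length (insertion_tableau w)"
  using assms
proof (induction "length w" arbitrary: w j rule: less_induct)
  case less
  obtain c where c: "subseq c w" "sorted_wrt (>) c" "length c = j"
    using less.prems by (auto simp: has_chain_def)
  show ?case
  proof (cases c rule: rev_cases)
    case (snoc c' x)
    then have "w \<noteq> []" using c by auto
    then obtain r b where rb: "row_pass w r b" "insertion_tableau w = r # insertion_tableau b"
      using row_pass_exists less.prems by blast
    have "has_chain (>) (length c') b"
    proof -
      from row_pass_decreasing_down[OF rb(1), of c' x] c snoc consider
        s where "subseq s b" "sorted_wrt (>) (s @ [x])" "length s = length c'" |
        s where "subseq s b" "sorted_wrt (>) s" "length s = Suc (length c')" by auto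
      then show ?thesis
      proof cases
        case 1
        then show ?thesis by (auto simp: has_chain_def sorted_wrt_append)
      next
        case 2
        \<comment> \<open>Here no letter was lost; one is dropped so that both cases give the same
          length.\<close>
        then have "subseq (butlast s) b" "sorted_wrt (>) (butlast s)"
          "length (butlast s) = length c'"
          by (cases s rule: rev_cases; auto simp: sorted_wrt_append
              intro: subseq_order.trans[OF subseq_rev_drop_many[OF subseq_order.refl]])+
        then show ?thesis unfolding has_chain_def by blast
      qed
    qed
    moreover have "distinct b" using row_pass_mset[OF rb(1)] less.prems(1)
      by (metis distinct_append mset_append mset_eq_imp_distinct_iff)
    ultimately show ?thesis
      using less.hyps[OF row_pass_length_less[OF rb(1) \<open>w \<noteq> []\<close>], of "length c'"] rb(2) snoc c
      by simp
  qed (use c in simp)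
qed

text \<open>By induction \<open>b\<close> has a decreasing subsequence with one letter per lower
  row. The first row contains a letter below its last one, and lifting the extended chain to
  \<open>w\<close> gains one letter for the first row.\<close>

lemma insertion_tableau_decreasing_exists:
  assumes "distinct w"
  shows "has_chain (>) (length (insertion_tableau w)) w"
  using assms
proof (induction "length w" arbitrary: w rule: less_induct)
  case less
  show ?case
  proof (cases "w = []")
    case True
    then show ?thesis by (auto simp: has_chain_def insertion_tableau_def)
  next
    case False
    then obtain r b where rb: "row_pass w r b" "insertion_tableau w = r # insertion_tableau b"
      using row_pass_exists less.prems by blast
    have "distinct b" using row_pass_mset[OF rb(1)] less.prems(1)
      by (metis distinct_append mset_append mset_eq_imp_distinct_iff)
    with less.hyps[OF row_pass_length_less[OF rb(1) False]] obtain s where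
      s: "subseq s b" "sorted_wrt (>) s" "length s = length (insertion_tableau b)"
      by (auto simp: has_chain_def)
    obtain e where e: "e \<in> set r" "sorted_wrt (>) (s @ [e])"
    proof (cases "s = []")
      case True
      have "r \<noteq> []" using rb(1) False by (cases rule: row_pass.cases) auto
      then show ?thesis using True that[of "hd r"] by simp
    next
      case False
      then have "last s \<in> set b" using set_nths_subset s(1) by (metis last_in_set subseq_conv_nths subsetD)
      then obtain e where "e \<in> set r" "e < last s" using row_pass_bumped_less[OF rb(1)] by blast
      moreover have "\<forall>y\<in>set s. last s \<le> y" using s(2) False
        by (cases s rule: rev_cases) (auto simp: sorted_wrt_append)
      ultimately have "\<forall>y\<in>set s. e < y" using less_le_trans[of e "last s"] by blast
      then show ?thesis using that[OF \<open>e \<in> set r\<close>] s(2) by (simp add: sorted_wrt_append)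
    qed
    from row_pass_decreasing_up[OF rb(1) s(1), of e] e obtain c where
      "subseq c w" "sorted_wrt (>) c" "length c = Suc (length s)" by blast
    then show ?thesis using s(3) rb(2) unfolding has_chain_def by auto
  qed
qed

lemma insertion_tableau_sizes:
  assumes "distinct w"
  shows "sum_list (map length (insertion_tableau w)) = length w \<and> [] \<notin> set (insertion_tableau w)"
  using assms
proof (induction "length w" arbitrary: w rule: less_induct)
  case less
  show ?case
  proof (cases "w = []")
    case True
    then show ?thesis by (simp add: insertion_tableau_def)
  next
    case False
    then obtain r b where rb: "row_pass w r b" "insertion_tableau w = r # insertion_tableau b"
      using row_pass_exists less.prems by blast
    have "distinct b" using row_pass_mset[OF rb(1)] less.prems(1)
      by (metis distinct_append mset_append mset_eq_imp_distinct_iff)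
    with less.hyps[OF row_pass_length_less[OF rb(1) False]] rb
      arg_cong[OF row_pass_mset[OF rb(1)], of size] row_pass_length_less[OF rb(1) False]
    show ?thesis by auto
  qed
qed

section \<open>Hook patterns and crossing chains\<close>

definition same_order :: "nat list \<Rightarrow> nat list \<Rightarrow> bool" where
  "same_order q s \<longleftrightarrow> length q = length s \<and>
    (\<forall>j < length s. \<forall>l < length s. q ! j > q ! l \<longleftrightarrow> s ! j > s ! l)"

lemma avoids_iff: "avoids p s \<longleftrightarrow> \<not> (\<exists>q. subseq q p \<and> same_order q s)"
  by (simp add: avoids_def same_order_def)

lemma same_order_sym: "same_order q s \<Longrightarrow> same_order s q"
  by (simp add: same_order_def)

lemma subseq_map_lift: "subseq c (map f z) \<Longrightarrow> \<exists>z'. subseq z' z \<and> c = map f z'"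
  by (metis nths_map subseq_conv_nths)

lemma subseq_set: "subseq c w \<Longrightarrow> set c \<subseteq> set w"
  by (metis set_nths_subset subseq_conv_nths)

text \<open>Zipping the two words carries a subsequence of \<open>s\<close> to the one of
  \<open>q\<close> at the same positions, which has the same relative order.\<close>

lemma has_chain_same_order:
  assumes "same_order q s" "has_chain R j s" "R = (<) \<or> R = (>)"
  shows "has_chain R j q"
proof -
  have len: "length q = length s" using assms(1) by (simp add: same_order_def)
  have iso: "snd a < snd b \<longleftrightarrow> fst a < fst b" if "a \<in> set (zip s q)" "b \<in> set (zip s q)" for a b
    using that assms(1) len by (auto simp: same_order_def set_zip)
  obtain c where c: "subseq c s" "sorted_wrt R c" "length c = j"
    using assms(2) by (auto simp: has_chain_def)
  then obtain z where z: "subseq z (zip s q)" "c = map fst z"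
    using subseq_map_lift[of c fst "zip s q"] len by auto
  have "sorted_wrt (\<lambda>a b. R (fst a) (fst b)) z" using c(2) z(2) by (simp add: sorted_wrt_map)
  moreover have "R (snd a) (snd b)" if "a \<in> set z" "b \<in> set z" "R (fst a) (fst b)" for a b
    using that assms(3) iso[of a b] iso[of b a] subseq_set[OF z(1)] by blast
  ultimately have "sorted_wrt (\<lambda>a b. R (snd a) (snd b)) z"
    by (rule sorted_wrt_mono_rel[rotated])
  then have "sorted_wrt R (map snd z)" by (simp add: sorted_wrt_map)
  moreover have "subseq (map snd z) q" using subseq_map[OF z(1), of snd] len by simp
  ultimately show ?thesis using c(3) z(2) by (auto simp: has_chain_def)
qed

text \<open>A first row of length at least \<open>m\<close> and at least \<open>k - 1\<close>
  further nonempty rows already use up all \<open>m + k - 1\<close> cells. So every inequality is an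
  equality and the lower rows are single cells.\<close>

lemma hook_shape_iff:
  assumes "distinct s" "m > 0" "k > 0" "length s = m + k - 1"
  shows "rs_shape s = hook m k \<longleftrightarrow> has_chain (<) m s \<and> has_chain (>) k s"
proof -
  define T where "T = insertion_tableau s"
  have "s \<noteq> []" using assms by auto
  note inc = insertion_tableau_first_row[OF assms(1) this, folded T_def]
  note dec = insertion_tableau_decreasing_le[OF assms(1), folded T_def]
    insertion_tableau_decreasing_exists[OF assms(1), folded T_def]
  note sz = insertion_tableau_sizes[OF assms(1), folded T_def]
  have "T \<noteq> []" using sz \<open>s \<noteq> []\<close> by auto
  then obtain r rs where T: "T = r # rs" by (cases T) auto
  have shape: "rs_shape s = length r # map length rs" by (simp add: rs_shape_eq T_def[symmetric] T)
  show ?thesis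
  proof
    assume "rs_shape s = hook m k"
    then have "length r = m" "length (map length rs) = length (replicate (k - 1) (1::nat))"
      by (auto simp: shape hook_def)
    then show "has_chain (<) m s \<and> has_chain (>) k s" using inc(1) dec(2) T assms(3) by simp
  next
    assume A: "has_chain (<) m s \<and> has_chain (>) k s"
    have "m \<le> length r" "k - 1 \<le> length rs" using A inc(2) dec(1) T by fastforce+
    moreover have ge: "length xs \<le> sum_list (map length xs)" if "[] \<notin> set xs" for xs :: "nat list list"
      using that
    proof (induction xs)
      case (Cons x xs)
      then show ?case by (cases x) auto
    qed simp
    have "length rs \<le> sum_list (map length rs)" using ge sz T by simp
    ultimately have eq: "length r = m" "length rs = k - 1" "sum_list (map length rs) = length rs"
      using sz T assms by auto
    have "map length xs = replicate (length xs) 1"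
      if "[] \<notin> set xs" "sum_list (map length xs) = length xs" for xs :: "nat list list"
      using that
    proof (induction xs)
      case (Cons x xs)
      have "length x \<ge> 1" using Cons.prems(1) by (cases x) auto
      moreover have "length xs \<le> sum_list (map length xs)" using ge Cons.prems(1) by simp
      ultimately show ?case using Cons by auto
    qed simp
    from this[of rs] show "rs_shape s = hook m k" using eq sz T by (simp add: shape hook_def)
  qed
qed

lemma standardization_exists:
  assumes "distinct q"
  shows "\<exists>s \<in> permutations_of_set {1..length q}. same_order q s"
proof -
  \<comment> \<open>The entry itself is counted, so that the ranks start at
    \<open>1\<close>.\<close>
  define rank where "rank x = card {z \<in> set q. z \<le> x}" for x
  have mono: "rank x < rank y" if "x < y" "y \<in> set q" for x y
  proof -
    have "{z \<in> set q. z \<le> x} \<subseteq> {z \<in> set q. z \<le> y}" "y \<in> {z \<in> set q. z \<le> y}"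
      "y \<notin> {z \<in> set q. z \<le> x}" using that by auto
    then show ?thesis unfolding rank_def by (intro psubset_card_mono) (auto simp del: mem_Collect_eq)
  qed
  have inj: "inj_on rank (set q)"
    by (rule inj_onI) (metis mono less_irrefl linorder_less_linear)
  have "rank ` set q \<subseteq> {1..length q}"
  proof
    fix t assume "t \<in> rank ` set q"
    then obtain x where x: "x \<in> set q" "t = rank x" by auto
    then have "0 < rank x" unfolding rank_def by (auto simp: card_gt_0_iff)
    moreover have "rank x \<le> card (set q)" unfolding rank_def by (intro card_mono) auto
    ultimately show "t \<in> {1..length q}" using x card_length[of q] by auto
  qed
  moreover have "card (rank ` set q) = card {1..length q}"
    using assms by (simp add: card_image[OF inj] distinct_card)
  ultimately have "rank ` set q = {1..length q}" by (intro card_subset_eq) auto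
  then have "map rank q \<in> permutations_of_set {1..length q}"
    using assms inj by (auto simp: permutations_of_set_def distinct_map)
  moreover have "same_order q (map rank q)"
    unfolding same_order_def using mono
    by (auto) (metis linorder_less_linear not_less_iff_gr_or_eq nth_mem)
  ultimately show ?thesis by blast
qed

lemma has_chain_subseq: "has_chain R j q \<Longrightarrow> subseq q p \<Longrightarrow> has_chain R j p"
  unfolding has_chain_def using subseq_order.trans by blast

text \<open>A pattern of hook shape brings chains of both kinds into \<open>p\<close>. This
  direction serves the lower bound.\<close>

lemma not_has_chain_imp_shape_avoiding:
  assumes "m > 0" "k > 0" "\<not> has_chain (<) m p \<or> \<not> has_chain (>) k p"
  shows "shape_avoiding (hook m k) p"
  unfolding shape_avoiding_def avoids_iff
proof (intro ballI impI notI, elim exE conjE)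
  fix s q assume s: "s \<in> permutations_of_set {1..sum_list (hook m k)}" "rs_shape s = hook m k"
    and q: "subseq q p" "same_order q s"
  have "distinct s" "length s = m + k - 1"
    using s(1) assms length_finite_permutations_of_set[OF s(1)]
    by (auto simp: permutations_of_set_def hook_def sum_list_replicate)
  with s(2) hook_shape_iff assms(1,2) have "has_chain (<) m s" "has_chain (>) k s" by auto
  then show False using has_chain_same_order[OF q(2)] has_chain_subseq[OF _ q(1)] assms(3) by metis
qed

section \<open>Ascents and descents as relations between entries\<close>

text \<open>The use of \<open>min\<close> and \<open>max\<close> makes the relation symmetric, so
  that increasing subsequences of \<open>p\<close> become sets of values on which
  \<open>asc p\<close> holds pairwise; \<open>desc\<close> does the same for decreasing
  ones.\<close>

definition asc :: "nat list \<Rightarrow> nat \<Rightarrow> nat \<Rightarrow> bool" where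
  "asc p x y \<longleftrightarrow> subseq [min x y, max x y] p"

definition desc :: "nat list \<Rightarrow> nat \<Rightarrow> nat \<Rightarrow> bool" where
  "desc p x y \<longleftrightarrow> subseq [max x y, min x y] p"

lemma asc_sym: "asc p x y \<longleftrightarrow> asc p y x" and desc_sym: "desc p x y \<longleftrightarrow> desc p y x"
  by (simp_all add: asc_def desc_def min.commute max.commute)

lemma subseq_pair_Cons: "subseq [x, y] (a # p) \<longleftrightarrow> x = a \<and> y \<in> set p \<or> subseq [x, y] p"
  by (metis list_emb_Cons subseq_Cons2_iff subseq_Cons2_neq subseq_singleton_left
      subseq_Cons2_iff subseq_Cons')

lemma subseq_pair_set: "subseq [x, y] p \<Longrightarrow> x \<in> set p \<and> y \<in> set p"
  using subseq_set[of "[x, y]" p] by simp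

lemma subseq_pair_antisym: "distinct p \<Longrightarrow> subseq [x, y] p \<Longrightarrow> \<not> subseq [y, x] p"
  by (induction p) (auto simp: subseq_pair_Cons simp del: subseq_Cons2_iff dest: subseq_pair_set)

lemma subseq_pair_trans:
  "distinct p \<Longrightarrow> subseq [x, y] p \<Longrightarrow> subseq [y, z] p \<Longrightarrow> subseq [x, z] p"
  by (induction p) (auto simp: subseq_pair_Cons simp del: subseq_Cons2_iff dest: subseq_pair_set)

lemma subseq_pair_total:
  "x \<in> set p \<Longrightarrow> y \<in> set p \<Longrightarrow> x \<noteq> y \<Longrightarrow> subseq [x, y] p \<or> subseq [y, x] p"
  by (induction p) (auto simp: subseq_pair_Cons simp del: subseq_Cons2_iff)

lemma sorted_wrt_iff_subseq_pair: "sorted_wrt R p \<longleftrightarrow> (\<forall>x y. subseq [x, y] p \<longrightarrow> R x y)"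
  by (induction p) (auto simp: subseq_pair_Cons simp del: subseq_Cons2_iff)

lemma asc_or_desc: "x \<in> set p \<Longrightarrow> y \<in> set p \<Longrightarrow> x \<noteq> y \<Longrightarrow> asc p x y \<or> desc p x y"
  using subseq_pair_total[of x p y] by (auto simp: asc_def desc_def min_def max_def)

lemma not_asc_and_desc: "distinct p \<Longrightarrow> asc p x y \<Longrightarrow> \<not> desc p x y"
  unfolding asc_def desc_def by (rule subseq_pair_antisym)

lemma asc_trans: "distinct p \<Longrightarrow> asc p x y \<Longrightarrow> asc p y z \<Longrightarrow> x \<le> y \<Longrightarrow> y \<le> z \<Longrightarrow> asc p x z"
  unfolding asc_def using subseq_pair_trans[of p x y z] by (auto simp: min_def max_def)

lemma subseq_rev: "subseq c p \<Longrightarrow> subseq (rev c) (rev p)"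
  by (induction rule: list_emb.induct) (auto intro: subseq_rev_drop_many)

lemma subseq_pair_rev: "subseq [x, y] (rev p) \<longleftrightarrow> subseq [y, x] p"
  using subseq_rev[of "[x, y]" "rev p"] subseq_rev[of "[y, x]" p] by auto

text \<open>Reversal exchanges the two relations, so each result about ascents has a mirror image
  for descents.\<close>

lemma asc_rev: "asc (rev p) = desc p" and desc_rev: "desc (rev p) = asc p"
  by (intro ext, simp add: asc_def desc_def subseq_pair_rev)+

lemma pairwise_asc_sorted:
  assumes "distinct p" "pairwise (asc p) S"
  shows "sorted_wrt (<) (filter (\<lambda>x. x \<in> S) p)"
  unfolding sorted_wrt_iff_subseq_pair
proof (intro allI impI)
  fix x y assume *: "subseq [x, y] (filter (\<lambda>x. x \<in> S) p)"
  have S: "x \<in> S" "y \<in> S" using subseq_set[OF *] by auto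
  have xy: "subseq [x, y] p" using subseq_order.trans[OF * subseq_filter_left] .
  then have "x \<noteq> y" using subseq_pair_antisym assms(1) by metis
  then have "asc p x y" using assms(2) S by (auto simp: pairwise_def)
  then show "x < y" using subseq_pair_antisym[OF assms(1) xy] \<open>x \<noteq> y\<close>
    by (auto simp: asc_def min_def max_def split: if_splits)
qed

lemma pairwise_desc_sorted:
  assumes "distinct p" "pairwise (desc p) S"
  shows "sorted_wrt (>) (filter (\<lambda>x. x \<in> S) p)"
proof -
  have "sorted_wrt (<) (filter (\<lambda>x. x \<in> S) (rev p))"
    by (rule pairwise_asc_sorted) (use assms in \<open>auto simp: asc_rev\<close>)
  then show ?thesis by (simp add: rev_filter[symmetric] sorted_wrt_rev)
qed

lemma length_filter_mem: "distinct p \<Longrightarrow> S \<subseteq> set p \<Longrightarrow> length (filter (\<lambda>x. x \<in> S) p) = card S"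
  using distinct_card[of "filter (\<lambda>x. x \<in> S) p"]
  by (simp add: Int_absorb1 Int_def[symmetric] Collect_conj_eq)

text \<open>Two common elements of \<open>S\<close> and \<open>T\<close> would form both an ascent
  and a descent, so the sets meet only in \<open>x\<close> and the union has
  \<open>m + k - 1\<close> entries. The standardization of these entries contains both chains and
  therefore has hook shape.\<close>

lemma crossing_chains_not_shape_avoiding:
  assumes "distinct p" "m > 0" "k > 0"
    and S: "S \<subseteq> set p" "pairwise (asc p) S" "card S = m"
    and T: "T \<subseteq> set p" "pairwise (desc p) T" "card T = k"
    and x: "x \<in> S" "x \<in> T"
  shows "\<not> shape_avoiding (hook m k) p"
proof -
  define q where "q = filter (\<lambda>x. x \<in> S \<union> T) p"
  have fin: "finite S" "finite T" using S(1) T(1) finite_subset by blast+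
  have "S \<inter> T = {x}"
  proof -
    have "y = x" if "y \<in> S" "y \<in> T" for y
    proof (rule ccontr)
      assume "y \<noteq> x"
      then have "asc p y x" "desc p y x" using pairwiseD[OF S(2)] pairwiseD[OF T(2)] that x by auto
      then show False using not_asc_and_desc[OF assms(1)] by simp
    qed
    with x show ?thesis by blast
  qed
  then have "card (S \<union> T) = m + k - 1"
    using card_Un_Int[OF fin] S(3) T(3) by simp
  moreover have "length q = card (S \<union> T)" unfolding q_def
    by (rule length_filter_mem[OF assms(1)]) (use S(1) T(1) in blast)
  ultimately have len: "length q = m + k - 1" by simp
  have q: "distinct q" "subseq q p" using assms(1) by (simp_all add: q_def)
  have absorb: "(x \<in> S \<or> x \<in> T) \<and> x \<in> S \<longleftrightarrow> x \<in> S"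
    "(x \<in> S \<or> x \<in> T) \<and> x \<in> T \<longleftrightarrow> x \<in> T" for x by blast+
  have "has_chain (<) m q"
    unfolding has_chain_def
  proof (intro exI conjI)
    show "subseq (filter (\<lambda>x. x \<in> S) p) q"
      using subseq_filter_left[of "\<lambda>x. x \<in> S" q] unfolding q_def filter_filter
      by (simp add: absorb)
    show "sorted_wrt (<) (filter (\<lambda>x. x \<in> S) p)" using pairwise_asc_sorted assms(1) S(2) .
    show "length (filter (\<lambda>x. x \<in> S) p) = m" using length_filter_mem assms(1) S by blast
  qed
  moreover have "has_chain (>) k q"
    unfolding has_chain_def
  proof (intro exI conjI)
    show "subseq (filter (\<lambda>x. x \<in> T) p) q"
      using subseq_filter_left[of "\<lambda>x. x \<in> T" q] unfolding q_def filter_filter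
      by (simp add: absorb)
    show "sorted_wrt (>) (filter (\<lambda>x. x \<in> T) p)" using pairwise_desc_sorted assms(1) T(2) .
    show "length (filter (\<lambda>x. x \<in> T) p) = k" using length_filter_mem assms(1) T by blast
  qed
  moreover obtain s where s: "s \<in> permutations_of_set {1..m + k - 1}" "same_order q s"
    using standardization_exists[OF q(1)] len by auto
  ultimately have "has_chain (<) m s" "has_chain (>) k s"
    using has_chain_same_order[OF same_order_sym[OF s(2)]] by auto
  moreover have "distinct s" "length s = m + k - 1"
    using s len by (auto simp: permutations_of_set_def same_order_def)
  ultimately have "rs_shape s = hook m k" using hook_shape_iff assms(2,3) by blast
  moreover have "sum_list (hook m k) = m + k - 1"
    using assms(3) by (simp add: hook_def sum_list_replicate)
  ultimately show ?thesis
    using s q(2) unfolding shape_avoiding_def avoids_iff by auto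
qed

section \<open>The upper bound\<close>

text \<open>Let \<open>h x\<close> be the size of the largest ascending set in \<open>A\<close> with
  maximum \<open>x\<close>. It strictly grows along ascents and lies between \<open>1\<close> and
  \<open>d\<close>, so \<open>h x - 1\<close> is a colouring whose classes contain only
  descents.\<close>

lemma asc_free_colouring:
  assumes "distinct p" "A \<subseteq> set p"
    and free: "\<And>S. S \<subseteq> A \<Longrightarrow> pairwise (asc p) S \<Longrightarrow> card S \<noteq> Suc d"
  shows "\<exists>g :: nat \<Rightarrow> nat. (\<forall>x\<in>A. g x < d) \<and>
    (\<forall>x\<in>A. \<forall>y\<in>A. x \<noteq> y \<longrightarrow> g x = g y \<longrightarrow> desc p x y)"
proof -
  have "finite A" using assms(2) finite_subset by blast
  define F where "F x = {S. S \<subseteq> A \<and> pairwise (asc p) S \<and> x \<in> S \<and> (\<forall>s\<in>S. s \<le> x)}" for x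
  define h where "h x = Max (card ` F x)" for x
  have fin: "finite (F x)" for x
    by (rule finite_subset[of _ "Pow A"]) (auto simp: F_def \<open>finite A\<close>)
  have single: "{x} \<in> F x" if "x \<in> A" for x using that by (simp add: F_def)
  have h_ge: "card S \<le> h x" if "S \<in> F x" for S x
    unfolding h_def using fin that by simp
  have h_ex: "\<exists>S\<in>F x. card S = h x" if "x \<in> A" for x
  proof -
    have "h x \<in> card ` F x" unfolding h_def using fin single[OF that] by (intro Max_in) auto
    then show ?thesis by auto
  qed
  have pos: "0 < h x" if "x \<in> A" for x using h_ge[OF single[OF that]] by simp
  have le: "h x \<le> d" if "x \<in> A" for x
  proof (rule ccontr)
    assume "\<not> h x \<le> d"
    with h_ex[OF that] obtain S where S: "S \<in> F x" "Suc d \<le> card S" by fastforce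
    then obtain S' where S': "S' \<subseteq> S" "card S' = Suc d" by (meson obtain_subset_with_card_n)
    then have "pairwise (asc p) S'" "S' \<subseteq> A" using S(1) pairwise_subset by (auto simp: F_def)
    then show False using free S'(2) by blast
  qed
  have step: "h x < h y" if xy: "x \<in> A" "y \<in> A" "asc p x y" "x < y" for x y
  proof -
    obtain S where S: "S \<in> F x" "card S = h x" using h_ex xy(1) by blast
    have "asc p s y" if "s \<in> S" for s
    proof (cases "s = x")
      case False
      then have "asc p s x" "s \<le> x" using S(1) that by (auto simp: F_def pairwise_def)
      then show ?thesis using asc_trans[OF assms(1)] xy by simp
    qed (use xy in simp)
    then have "pairwise (asc p) (insert y S)" using S(1)
      by (auto simp: F_def pairwise_insert asc_sym)
    then have "insert y S \<in> F y" using S(1) xy by (fastforce simp: F_def)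
    moreover have "y \<notin> S" using S(1) xy by (auto simp: F_def)
    moreover have "finite S" using S(1) \<open>finite A\<close> finite_subset by (auto simp: F_def)
    ultimately show ?thesis using h_ge[of "insert y S" y] S(2) by simp
  qed
  have "desc p x y" if "x \<in> A" "y \<in> A" "x \<noteq> y" "h x - 1 = h y - 1" for x y
  proof (rule ccontr)
    assume "\<not> desc p x y"
    then have "asc p x y" using asc_or_desc that assms(2) by blast
    then have "h x < h y \<or> h y < h x" using step that asc_sym by (meson linorder_neqE_nat)
    then show False using that pos[of x] pos[of y] by auto
  qed
  moreover have "h x - 1 < d" if "x \<in> A" for x using pos[OF that] le[OF that] by simp
  ultimately show ?thesis by (intro exI[of _ "\<lambda>x. h x - 1"]) blast
qed

text \<open>Pigeonhole for the preceding colouring: if each of the \<open>d\<close> classes had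
  fewer than \<open>N\<close> entries, \<open>A\<close> would have at most
  \<open>d * N\<close>.\<close>

lemma erdos_szekeres:
  assumes "distinct p" "A \<subseteq> set p"
    and free: "\<And>S. S \<subseteq> A \<Longrightarrow> pairwise (asc p) S \<Longrightarrow> card S \<noteq> Suc d"
    and large: "d * N < card A"
  shows "\<exists>D \<subseteq> A. pairwise (desc p) D \<and> card D = N"
proof -
  have "finite A" using assms(2) finite_subset by blast
  obtain g :: "nat \<Rightarrow> nat" where g: "\<forall>x\<in>A. g x < d"
    "\<forall>x\<in>A. \<forall>y\<in>A. x \<noteq> y \<longrightarrow> g x = g y \<longrightarrow> desc p x y"
    using asc_free_colouring[OF assms(1-3)] by blast
  have "\<exists>c<d. N \<le> card {x\<in>A. g x = c}"
  proof (rule ccontr)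
    assume "\<not> ?thesis"
    then have small: "card {x\<in>A. g x = c} \<le> N" if "c < d" for c using that by force
    have "A = (\<Union>c\<in>{..<d}. {x\<in>A. g x = c})" using g(1) by auto
    then have "card A \<le> (\<Sum>c\<in>{..<d}. card {x\<in>A. g x = c})"
      by (metis card_UN_le finite_lessThan)
    also have "\<dots> \<le> (\<Sum>c\<in>{..<d}. N)" using small by (intro sum_mono) auto
    finally show False using large by simp
  qed
  then obtain c where "N \<le> card {x\<in>A. g x = c}" by blast
  then obtain D where "D \<subseteq> {x\<in>A. g x = c}" "card D = N" by (meson obtain_subset_with_card_n)
  then show ?thesis using g(2) by (intro exI[of _ D]) (auto simp: pairwise_def)
qed

text \<open>If \<open>m - 1\<close> elements of \<open>C\<close> were related to \<open>a\<close>,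
  adding \<open>a\<close> would give a forbidden set of size \<open>m\<close>.\<close>

lemma card_related_lt:
  assumes "finite C" "a \<notin> C" "pairwise R C" "\<And>x y. R x y \<longleftrightarrow> R y x" "0 < m"
    and no: "\<And>S. S \<subseteq> insert a C \<Longrightarrow> pairwise R S \<Longrightarrow> a \<in> S \<Longrightarrow> card S \<noteq> m"
  shows "card {c \<in> C. R a c} < m"
proof (rule ccontr)
  assume "\<not> ?thesis"
  then have "m - 1 \<le> card {c \<in> C. R a c}" by simp
  then obtain S where S: "S \<subseteq> {c \<in> C. R a c}" "card S = m - 1"
    by (meson obtain_subset_with_card_n)
  have "finite S" using S(1) assms(1) finite_subset by fastforce
  moreover have "a \<notin> S" using S(1) assms(2) by auto
  ultimately have "card (insert a S) = m" using S(2) assms(5) by simp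
  moreover have "pairwise R (insert a S)"
    using S(1) assms(4)[of a] pairwise_subset[OF assms(3), of S] by (auto simp: pairwise_insert)
  ultimately show False using no[of "insert a S"] S(1) by auto
qed

text \<open>Each pair in \<open>C \<times> D\<close> is an ascent or a descent. An element of \<open>D\<close> is in less than \<open>m\<close>
  ascents and an element of \<open>C\<close> in less than \<open>k\<close> descents, so \<open>N\<^sup>2 \<le> N (m - 1) + N (k - 1)\<close>.\<close>

lemma monotone_sets_not_both_long:
  assumes "distinct p" "0 < m" "0 < k"
    and C: "C \<subseteq> set p" "pairwise (asc p) C" "card C = m + k"
    and D: "D \<subseteq> set p" "pairwise (desc p) D" "card D = m + k"
    and disj: "C \<inter> D = {}"
    and noC: "\<And>c T. c \<in> C \<Longrightarrow> T \<subseteq> set p \<Longrightarrow> pairwise (desc p) T \<Longrightarrow> c \<in> T \<Longrightarrow> card T \<noteq> k"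
    and noD: "\<And>d S. d \<in> D \<Longrightarrow> S \<subseteq> set p \<Longrightarrow> pairwise (asc p) S \<Longrightarrow> d \<in> S \<Longrightarrow> card S \<noteq> m"
  shows False
proof -
  have fin: "finite C" "finite D" using C(1) D(1) finite_subset by blast+
  have a: "card {c \<in> C. asc p d c} \<le> m - 1" if "d \<in> D" for d
  proof -
    have "card {c \<in> C. asc p d c} < m"
    proof (rule card_related_lt[OF _ _ C(2) asc_sym assms(2)])
      show "card S \<noteq> m" if S: "S \<subseteq> insert d C" "pairwise (asc p) S" "d \<in> S" for S
        using noD[OF \<open>d \<in> D\<close> _ S(2,3)] S(1) C(1) D(1) \<open>d \<in> D\<close> by blast
    qed (use fin disj that in auto)
    then show ?thesis by simp
  qed
  have b: "card {d \<in> D. desc p c d} \<le> k - 1" if "c \<in> C" for c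
  proof -
    have "card {d \<in> D. desc p c d} < k"
    proof (rule card_related_lt[OF _ _ D(2) desc_sym assms(3)])
      show "card S \<noteq> k" if S: "S \<subseteq> insert c D" "pairwise (desc p) S" "c \<in> S" for S
        using noC[OF \<open>c \<in> C\<close> _ S(2,3)] S(1) C(1) D(1) \<open>c \<in> C\<close> by blast
    qed (use fin disj that in auto)
    then show ?thesis by simp
  qed
  \<comment> \<open>Ascents are counted from the side of \<open>D\<close> and descents from the side
    of \<open>C\<close>, hence the swap.\<close>
  have "C \<times> D \<subseteq> prod.swap ` (SIGMA d:D. {c \<in> C. asc p d c}) \<union> (SIGMA c:C. {d \<in> D. desc p c d})"
  proof
    fix z assume "z \<in> C \<times> D"
    then obtain c d where z: "z = (c, d)" "c \<in> C" "d \<in> D" by auto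
    then have "asc p c d \<or> desc p c d" using asc_or_desc[of c p d] C(1) D(1) disj by auto
    with z show "z \<in> prod.swap ` (SIGMA d:D. {c \<in> C. asc p d c}) \<union> (SIGMA c:C. {d \<in> D. desc p c d})"
      using asc_sym by force
  qed
  then have "card (C \<times> D) \<le>
      card (prod.swap ` (SIGMA d:D. {c \<in> C. asc p d c}) \<union> (SIGMA c:C. {d \<in> D. desc p c d}))"
    using fin by (intro card_mono) auto
  also have "\<dots> \<le> card (SIGMA d:D. {c \<in> C. asc p d c}) + card (SIGMA c:C. {d \<in> D. desc p c d})"
    by (intro order_trans[OF card_Un_le] add_mono card_image_le) (use fin in auto)
  also have "\<dots> = (\<Sum>d\<in>D. card {c \<in> C. asc p d c}) + (\<Sum>c\<in>C. card {d \<in> D. desc p c d})"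
    using fin by (simp add: card_SigmaI)
  also have "\<dots> \<le> (\<Sum>d\<in>D. m - 1) + (\<Sum>c\<in>C. k - 1)"
    using a b by (intro add_mono sum_mono) auto
  also have "\<dots> = (m + k) * ((m - 1) + (k - 1))" using C(3) D(3) by (simp add: add_mult_distrib2)
  also have "\<dots> < (m + k) * (m + k)" using assms(2,3) by (intro mult_strict_left_mono) auto
  finally show False using C(3) D(3) by (simp add: card_cartesian_product)
qed

section \<open>Colourings up to boundedly many exceptional entries\<close>

text \<open>Colours below \<open>D\<close> mark decreasing sequences. The \<open>K\<close> colours
  from \<open>D\<close> on are private to one entry each and absorb the exceptional entries.\<close>

definition almost_colourable :: "nat \<Rightarrow> nat \<Rightarrow> nat list \<Rightarrow> bool" where
  "almost_colourable D K p \<longleftrightarrow> (\<exists>g :: nat \<Rightarrow> nat. (\<forall>x\<in>set p. g x < D + K) \<and>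
    (\<forall>x\<in>set p. \<forall>y\<in>set p. x \<noteq> y \<longrightarrow> g x = g y \<longrightarrow> g x < D \<and> desc p x y))"

lemma almost_colourableI:
  assumes "distinct p" "A \<subseteq> set p" "card (set p - A) \<le> K" "d \<le> D"
    and free: "\<And>S. S \<subseteq> A \<Longrightarrow> pairwise (asc p) S \<Longrightarrow> card S \<noteq> Suc d"
  shows "almost_colourable D K p"
proof -
  obtain g :: "nat \<Rightarrow> nat" where g: "\<forall>x\<in>A. g x < d"
    "\<forall>x\<in>A. \<forall>y\<in>A. x \<noteq> y \<longrightarrow> g x = g y \<longrightarrow> desc p x y"
    using asc_free_colouring[OF assms(1,2) free] by blast
  have "\<exists>h. inj_on h (set p - A) \<and> h ` (set p - A) \<subseteq> {..<K}"
    using inj_on_iff_card_le[of "set p - A" "{..<K}"] assms(3) by simp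
  then obtain h where h: "inj_on h (set p - A)" "h ` (set p - A) \<subseteq> {..<K}" by blast
  define g' where "g' x = (if x \<in> A then g x else D + h x)" for x
  have "g' x < D + K" if "x \<in> set p" for x
    using that g(1) h(2) assms(4) by (auto simp: g'_def trans_less_add1)
  moreover have "g' x < D \<and> desc p x y"
    if "x \<in> set p" "y \<in> set p" "x \<noteq> y" "g' x = g' y" for x y
    using that g h(1) assms(4) by (auto simp: g'_def inj_on_def split: if_splits)
  ultimately show ?thesis unfolding almost_colourable_def by blast
qed

lemma shape_avoiding_almost_colourable:
  assumes "distinct p" "0 < m" "0 < k" "shape_avoiding (hook m k) p"
    and D: "D = max (m - 1) (k - 1)" and K: "K = (m + k) * (m + k)"
  shows "almost_colourable D K p \<or> almost_colourable D K (rev p)"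
proof -
  define A where "A = {x \<in> set p. \<forall>S \<subseteq> set p. pairwise (asc p) S \<longrightarrow> x \<in> S \<longrightarrow> card S \<noteq> m}"
  define B where "B = set p - A"
  have sub: "A \<subseteq> set p" "B \<subseteq> set p" by (auto simp: A_def B_def)
  have noA: "card S \<noteq> m" if "S \<subseteq> set p" "pairwise (asc p) S" "x \<in> S" "x \<in> A" for S x
    using that by (auto simp: A_def)
  \<comment> \<open>An entry outside \<open>A\<close> lies in an ascending set of size
    \<open>m\<close>, so a descending set of size \<open>k\<close> through it would cross that
    set.\<close>
  have noB: "card T \<noteq> k" if T: "T \<subseteq> set p" "pairwise (desc p) T" "x \<in> T" "x \<in> B" for T x
  proof
    assume "card T = k"
    from T(4) obtain S where "S \<subseteq> set p" "pairwise (asc p) S" "x \<in> S" "card S = m"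
      by (auto simp: A_def B_def)
    from crossing_chains_not_shape_avoiding[OF assms(1-3) this(1,2,4) T(1,2) \<open>card T = k\<close> this(3) T(3)]
    show False using assms(4) by simp
  qed
  have freeA: "card S \<noteq> Suc (m - 1)" if "S \<subseteq> A" "pairwise (asc p) S" for S
  proof
    assume *: "card S = Suc (m - 1)"
    then obtain x where "x \<in> S" by fastforce
    then show False using noA[of S x] that sub * assms(2) by auto
  qed
  have freeB: "card S \<noteq> Suc (k - 1)" if "S \<subseteq> B" "pairwise (asc (rev p)) S" for S
  proof
    assume *: "card S = Suc (k - 1)"
    then obtain x where "x \<in> S" by fastforce
    then show False using noB[of S x] that sub * assms(3) by (auto simp: asc_rev)
  qed
  have "card A \<le> K \<or> card B \<le> K"
  proof (rule ccontr)
    assume "\<not> ?thesis"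
    \<comment> \<open>The constant \<open>K\<close> is chosen to exceed both thresholds of the
      Erdos-Szekeres argument for monotone sets of length \<open>m + k\<close>.\<close>
    then have big: "(m - 1) * (m + k) < card A" "(k - 1) * (m + k) < card B"
      unfolding K by (auto elim!: le_less_trans[rotated] simp: not_le intro!: mult_le_mono1)
    obtain E where E: "E \<subseteq> A" "pairwise (desc p) E" "card E = m + k"
      using erdos_szekeres[OF assms(1) sub(1) freeA big(1)] by blast
    obtain C where C: "C \<subseteq> B" "pairwise (asc p) C" "card C = m + k"
      using erdos_szekeres[of "rev p" B "k - 1" "m + k"] freeB big(2) assms(1) sub(2)
      by (auto simp: desc_rev)
    show False
    proof (rule monotone_sets_not_both_long[of p m k C E])
      show "card T \<noteq> k" if "c \<in> C" "T \<subseteq> set p" "pairwise (desc p) T" "c \<in> T" for c T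
        using noB[OF that(2-4)] that(1) C(1) by blast
      show "card S \<noteq> m" if "d \<in> E" "S \<subseteq> set p" "pairwise (asc p) S" "d \<in> S" for d S
        using noA[OF that(2-4)] that(1) E(1) by blast
    qed (use assms(1-3) E C sub in \<open>auto simp: B_def\<close>)
  qed
  \<comment> \<open>The smaller part supplies the exceptional entries. If that is \<open>A\<close>,
    the word is reversed, since \<open>B\<close> splits into increasing sequences.\<close>
  then show ?thesis
  proof
    assume "card B \<le> K"
    then have "almost_colourable D K p"
      using almost_colourableI[OF assms(1) sub(1) _ _ freeA, of K D] D by (simp add: B_def)
    then show ?thesis ..
  next
    assume "card A \<le> K"
    moreover have "set p - B = A" using sub by (auto simp: B_def)
    ultimately have "almost_colourable D K (rev p)"
      using almost_colourableI[of "rev p" B K "k - 1" D] freeB sub assms(1) D by simp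
    then show ?thesis ..
  qed
qed

section \<open>Counting almost colourable permutations by colour words\<close>

text \<open>These are the words that the colours of an almost colourable permutation can
  form.\<close>

definition almost_words :: "nat \<Rightarrow> nat \<Rightarrow> nat \<Rightarrow> nat list set" where
  "almost_words D K n = {w. length w = n \<and> set w \<subseteq> {..<D + K} \<and>
    (\<forall>i<n. \<forall>j<n. i \<noteq> j \<longrightarrow> w ! i = w ! j \<longrightarrow> w ! i < D)}"

lemma finite_almost_words: "finite (almost_words D K n)"
  by (rule finite_subset[OF _ finite_lists_length_eq[of "{..<D + K}" n]])
    (auto simp: almost_words_def)

text \<open>Each exceptional letter costs a factor \<open>n + 1\<close>: the letter
  \<open>D + K\<close> is written over position \<open>i\<close> of a word without it. The choice
  \<open>i = n\<close> is out of range, leaves the list unchanged and stands for the absence of the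
  letter.\<close>

lemma card_almost_words:
  assumes "0 < D"
  shows "card (almost_words D K n) \<le> D ^ n * (n + 1) ^ K"
proof (induction K)
  case 0
  have "almost_words D 0 n \<subseteq> {w. set w \<subseteq> {..<D} \<and> length w = n}"
    by (auto simp: almost_words_def)
  from card_mono[OF finite_lists_length_eq[OF finite_lessThan] this] show ?case
    by (simp add: card_lists_length_eq)
next
  case (Suc K)
  have "almost_words D (Suc K) n \<subseteq> (\<lambda>(w, i). w[i := D + K]) ` (almost_words D K n \<times> {..n})"
  proof
    fix w assume w: "w \<in> almost_words D (Suc K) n"
    then have len: "length w = n" by (simp add: almost_words_def)
    have *: "\<And>i j. i < n \<Longrightarrow> j < n \<Longrightarrow> i \<noteq> j \<Longrightarrow> w ! i = w ! j \<Longrightarrow> w ! i < D"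
      using w by (auto simp: almost_words_def)
    have bound: "w ! i < Suc (D + K)" if "i < n" for i
    proof -
      have "set w \<subseteq> {..<D + Suc K}" using w by (simp add: almost_words_def)
      then show ?thesis using nth_mem[of i w] that len by fastforce
    qed
    show "w \<in> (\<lambda>(w, i). w[i := D + K]) ` (almost_words D K n \<times> {..n})"
    proof (cases "D + K \<in> set w")
      case True
      then obtain i where i: "i < n" "w ! i = D + K" using len by (auto simp: in_set_conv_nth)
      have "w ! j \<noteq> D + K" if "j < n" "j \<noteq> i" for j using *[of j i] i that by auto
      then have "w ! j < D + K" if "j < n" "j \<noteq> i" for j using bound[of j] that by fastforce
      moreover have upd: "w[i := 0] ! j = (if j = i then 0 else w ! j)" if "j < n" for j
        using that len by (simp add: nth_list_update)
      \<comment> \<open>Since \<open>0 < D\<close>, the letter \<open>0\<close> may repeat and is a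
        safe replacement.\<close>
      ultimately have "w[i := 0] \<in> almost_words D K n"
        using * len assms by (auto simp: almost_words_def upd set_conv_nth split: if_splits)
      moreover have "w = (w[i := 0])[i := D + K]" using i len by (metis list_update_id list_update_overwrite)
      ultimately show ?thesis using i(1) by (intro image_eqI[of _ _ "(w[i := 0], i)"]) auto
    next
      case False
      then have "w ! i < D + K" if "i < n" for i using bound[OF that] that len nth_mem[of i w]
        by (metis less_antisym)
      then have "w \<in> almost_words D K n"
        using * len by (auto simp: almost_words_def set_conv_nth)
      moreover have "w = w[n := D + K]" using len by (simp add: list_update_beyond)
      ultimately show ?thesis by (intro image_eqI[of _ _ "(w, n)"]) auto
    qed
  qed
  then have "card (almost_words D (Suc K) n) \<le>
      card ((\<lambda>(w, i). w[i := D + K]) ` (almost_words D K n \<times> {..n}))"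
    by (intro card_mono finite_imageI finite_cartesian_product finite_almost_words) auto
  also have "\<dots> \<le> card (almost_words D K n \<times> {..n})"
    by (intro card_image_le finite_cartesian_product finite_almost_words) auto
  also have "\<dots> = card (almost_words D K n) * (n + 1)" by (simp add: card_cartesian_product)
  also have "\<dots> \<le> D ^ n * (n + 1) ^ K * (n + 1)" using Suc by (intro mult_le_mono1)
  finally show ?case by (simp add: algebra_simps)
qed

text \<open>The colour word tells from which class the next entry is taken, and the list of that
  class tells which entry it is.\<close>

lemma map_filter_determine:
  "map g p = map g q \<Longrightarrow> (\<And>c. filter (\<lambda>x. g x = c) p = filter (\<lambda>x. g x = c) q) \<Longrightarrow> p = q"
proof (induction p arbitrary: q)
  case (Cons a p)
  then obtain b q' where q: "q = b # q'" "g a = g b" "map g p = map g q'" by (cases q) auto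
  have "a = b" using Cons.prems(2)[of "g a"] q by simp
  moreover have "filter (\<lambda>x. g x = c) p = filter (\<lambda>x. g x = c) q'" for c
    using Cons.prems(2)[of c] q by (cases "g a = c") auto
  ultimately show ?case using Cons.IH q by simp
qed simp

lemma sorted_desc_unique:
  assumes "sorted_wrt (>) xs" "sorted_wrt (>) ys" "set xs = set ys"
  shows "xs = (ys :: nat list)"
proof -
  have "rev xs = rev ys"
    by (rule strict_sorted_equal) (use assms in \<open>auto simp: sorted_wrt_rev\<close>)
  then show ?thesis by simp
qed

text \<open>Each colour class is listed in decreasing order, so the set of its entries fixes its
  list; the colour word then interleaves the classes.\<close>

lemma desc_colouring_determines:
  assumes "distinct p" "distinct q" "set p = set q" "map g p = map g q"
    and p: "\<And>x y. x \<in> set p \<Longrightarrow> y \<in> set p \<Longrightarrow> x \<noteq> y \<Longrightarrow> g x = g y \<Longrightarrow> desc p x y"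
    and q: "\<And>x y. x \<in> set q \<Longrightarrow> y \<in> set q \<Longrightarrow> x \<noteq> y \<Longrightarrow> g x = g y \<Longrightarrow> desc q x y"
  shows "p = q"
proof (rule map_filter_determine[OF assms(4)])
  fix c
  have eq: "filter (\<lambda>x. g x = c) r = filter (\<lambda>x. x \<in> {x \<in> set r. g x = c}) r" for r
    by (rule filter_cong) auto
  show "filter (\<lambda>x. g x = c) p = filter (\<lambda>x. g x = c) q"
  proof (rule sorted_desc_unique)
    show "sorted_wrt (>) (filter (\<lambda>x. g x = c) p)"
      unfolding eq[of p] by (rule pairwise_desc_sorted[OF assms(1)]) (use p in \<open>auto simp: pairwise_def\<close>)
    show "sorted_wrt (>) (filter (\<lambda>x. g x = c) q)"
      unfolding eq[of q] by (rule pairwise_desc_sorted[OF assms(2)]) (use q in \<open>auto simp: pairwise_def\<close>)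
  qed (use assms(3) in simp)
qed

lemma card_almost_colourable:
  assumes "0 < D"
  shows "card {p \<in> permutations_of_set {1..n}. almost_colourable D K p} \<le> (D ^ n * (n + 1) ^ K)\<^sup>2"
proof -
  let ?P = "{p \<in> permutations_of_set {1..n}. almost_colourable D K p}"
  define good where "good p g \<longleftrightarrow> (\<forall>x\<in>set p. g x < D + K) \<and>
    (\<forall>x\<in>set p. \<forall>y\<in>set p. x \<noteq> y \<longrightarrow> g x = g y \<longrightarrow> g x < D \<and> desc p x y)" for p and g :: "nat \<Rightarrow> nat"
  define col where "col p = (SOME g. good p g)" for p
  have col: "good p (col p)" if "p \<in> ?P" for p
  proof -
    have "\<exists>g. good p g" using that unfolding almost_colourable_def good_def by simp
    then show ?thesis unfolding col_def by (rule someI_ex)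
  qed
  have P: "set p = {1..n}" "distinct p" "length p = n" if "p \<in> ?P" for p
    using that length_finite_permutations_of_set[of p "{1..n}"] by (auto simp: permutations_of_set_def)
  have words: "map g r \<in> almost_words D K n"
    if "good p g" "set p = {1..n}" "set r = {1..n}" "distinct r" "length r = n" for g p r
  proof -
    have "g (r ! i) < D" if "i < n" "j < n" "i \<noteq> j" "g (r ! i) = g (r ! j)" for i j
    proof -
      have "r ! i \<in> set p" "r ! j \<in> set p" "r ! i \<noteq> r ! j"
        using that \<open>length r = n\<close> \<open>distinct r\<close> \<open>set p = {1..n}\<close> \<open>set r = {1..n}\<close>
        by (auto simp: nth_eq_iff_index_eq simp flip: \<open>set r = {1..n}\<close>)
      then show ?thesis using \<open>good p g\<close> that(4) unfolding good_def by blast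
    qed
    then show ?thesis using that by (auto simp: almost_words_def good_def)
  qed
  \<comment> \<open>The first word lists colours by value and so recovers the colouring chosen for
    \<open>p\<close>; the second lists them by position. Two words account for the square.\<close>
  define \<Phi> where "\<Phi> p = (map (col p) [1..<Suc n], map (col p) p)" for p
  have "\<Phi> ` ?P \<subseteq> almost_words D K n \<times> almost_words D K n"
  proof
    fix z assume "z \<in> \<Phi> ` ?P"
    then obtain p where p: "p \<in> ?P" "z = \<Phi> p" by blast
    show "z \<in> almost_words D K n \<times> almost_words D K n"
      unfolding p(2) \<Phi>_def using words[OF col[OF p(1)] P(1)[OF p(1)]] P[OF p(1)]
      by (auto simp: atLeastLessThanSuc_atLeastAtMost simp del: upt_Suc)
  qed
  moreover have "inj_on \<Phi> ?P"
  proof (rule inj_onI)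
    fix p q assume p: "p \<in> ?P" and q: "q \<in> ?P" and eq: "\<Phi> p = \<Phi> q"
    then have same: "col p x = col q x" if "x \<in> {1..n}" for x
      using that by (auto simp: \<Phi>_def atLeastLessThanSuc_atLeastAtMost simp del: upt_Suc)
    show "p = q"
    proof (rule desc_colouring_determines)
      show "map (col p) p = map (col p) q"
        using eq same P(1)[OF q] by (auto simp: \<Phi>_def simp del: upt_Suc)
    qed (use P[OF p] P[OF q] col[OF p] col[OF q] same in \<open>auto simp: good_def\<close>)
  qed
  ultimately have "card ?P \<le> card (almost_words D K n \<times> almost_words D K n)"
    by (intro card_inj_on_le finite_cartesian_product finite_almost_words)
  also have "\<dots> = (card (almost_words D K n))\<^sup>2"
    by (simp add: card_cartesian_product power2_eq_square)
  also have "\<dots> \<le> (D ^ n * (n + 1) ^ K)\<^sup>2" using card_almost_words[OF assms] by (intro power_mono) auto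
  finally show ?thesis .
qed

lemma rev_permutations_of_set: "p \<in> permutations_of_set A \<Longrightarrow> rev p \<in> permutations_of_set A"
  by (simp add: permutations_of_set_def)

text \<open>The factor \<open>2\<close> covers the permutations for which only the reversal is
  almost colourable.\<close>

lemma avoid_count_le:
  assumes "0 < m" "0 < k" and D: "D = max (m - 1) (k - 1)" "0 < D" and K: "K = (m + k) * (m + k)"
  shows "avoid_count (hook m k) n \<le> 2 * (D ^ n * (n + 1) ^ K)\<^sup>2"
proof -
  let ?P = "{p \<in> permutations_of_set {1..n}. almost_colourable D K p}"
  have "{p \<in> permutations_of_set {1..n}. shape_avoiding (hook m k) p} \<subseteq> ?P \<union> rev ` ?P"
  proof
    fix p assume p: "p \<in> {p \<in> permutations_of_set {1..n}. shape_avoiding (hook m k) p}"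
    then have "almost_colourable D K p \<or> almost_colourable D K (rev p)"
      using shape_avoiding_almost_colourable[OF _ assms(1,2) _ D(1) K]
      by (auto simp: permutations_of_set_def)
    then show "p \<in> ?P \<union> rev ` ?P"
      using p rev_permutations_of_set[of p "{1..n}"] by (auto simp: image_iff intro: exI[of _ "rev p"])
  qed
  then have "avoid_count (hook m k) n \<le> card (?P \<union> rev ` ?P)"
    unfolding avoid_count_def by (intro card_mono) auto
  also have "\<dots> \<le> card ?P + card ?P"
    by (intro order_trans[OF card_Un_le] add_mono card_image_le) auto
  finally show ?thesis using card_almost_colourable[OF D(2), of n K] by simp
qed

section \<open>The lower bound\<close>

definition inc_free_perms :: "nat \<Rightarrow> nat \<Rightarrow> nat list set" where
  "inc_free_perms d n = {p \<in> permutations_of_set {1..n}. \<not> has_chain (<) (Suc d) p}"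

lemma subseq_Cons_cases: "subseq c (a # p) \<Longrightarrow> subseq c p \<or> (\<exists>c'. c = a # c' \<and> subseq c' p)"
  by (cases c) (auto split: if_splits)

text \<open>A new maximum put in front starts only increasing subsequences of length one, which is
  harmless as \<open>0 < d\<close>. This later carries bounds from special lengths to all
  lengths.\<close>

lemma card_inc_free_perms_mono:
  assumes "0 < d" "n \<le> n'"
  shows "card (inc_free_perms d n) \<le> card (inc_free_perms d n')"
proof -
  have "card (inc_free_perms d n) \<le> card (inc_free_perms d (Suc n))" for n
  proof (rule card_inj_on_le)
    show "(\<lambda>p. Suc n # p) ` inc_free_perms d n \<subseteq> inc_free_perms d (Suc n)"
    proof
      fix q assume "q \<in> (\<lambda>p. Suc n # p) ` inc_free_perms d n"
      then obtain p where p: "p \<in> permutations_of_set {1..n}" "\<not> has_chain (<) (Suc d) p" "q = Suc n # p"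
        by (auto simp: inc_free_perms_def)
      have set: "set p = {1..n}" using p(1) by (simp add: permutations_of_set_def)
      have "\<not> has_chain (<) (Suc d) q"
      proof
        assume "has_chain (<) (Suc d) q"
        then obtain c where c: "subseq c q" "sorted_wrt (<) c" "length c = Suc d"
          by (auto simp: has_chain_def)
        have "\<not> subseq c p" using p(2) c by (auto simp: has_chain_def)
        then obtain c' where c': "c = Suc n # c'" "subseq c' p"
          using subseq_Cons_cases[of c "Suc n" p] c(1) p(3) by auto
        then obtain y where "y \<in> set c'" using c(3) assms(1) by (cases c') auto
        then have "Suc n < y" "y \<in> {1..n}" using c(2) c' subseq_set[OF c'(2)] set by auto
        then show False by simp
      qed
      moreover have "q \<in> permutations_of_set {1..Suc n}"
        using p set by (auto simp: permutations_of_set_def)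
      ultimately show "q \<in> inc_free_perms d (Suc n)" by (simp add: inc_free_perms_def)
    qed
  qed (auto simp: inc_free_perms_def)
  then show ?thesis using lift_Suc_mono_le[of "\<lambda>n. card (inc_free_perms d n)"] assms(2) by blast
qed

text \<open>If \<open>k \<le> m\<close>, the permutations in question lack the increasing chain of
  length \<open>m\<close>. Otherwise their reversals lack the decreasing chain of length
  \<open>k\<close>.\<close>

lemma card_inc_free_perms_le_avoid_count:
  assumes "0 < m" "0 < k"
  shows "card (inc_free_perms (max (m - 1) (k - 1)) n) \<le> avoid_count (hook m k) n"
proof (cases "k \<le> m")
  case True
  then have "Suc (max (m - 1) (k - 1)) = m" using assms by simp
  then have "inc_free_perms (max (m - 1) (k - 1)) n \<subseteq>
      {p \<in> permutations_of_set {1..n}. shape_avoiding (hook m k) p}"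
    using not_has_chain_imp_shape_avoiding[OF assms] by (auto simp: inc_free_perms_def)
  then show ?thesis unfolding avoid_count_def by (intro card_mono) auto
next
  case False
  then have k: "Suc (max (m - 1) (k - 1)) = k" using assms by simp
  have "has_chain (<) k p" if chain: "has_chain (>) k (rev p)" for p
  proof -
    from chain obtain c where c: "subseq c (rev p)" "sorted_wrt (>) c" "length c = k"
      by (auto simp: has_chain_def)
    have "subseq (rev c) p" using subseq_rev[OF c(1)] by simp
    then show ?thesis using c(2,3) unfolding has_chain_def
      by (intro exI[of _ "rev c"]) (simp add: sorted_wrt_rev)
  qed
  then have "rev ` inc_free_perms (max (m - 1) (k - 1)) n \<subseteq>
      {p \<in> permutations_of_set {1..n}. shape_avoiding (hook m k) p}"
    using not_has_chain_imp_shape_avoiding[OF assms] k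
    by (auto simp: inc_free_perms_def permutations_of_set_def)
  then have "card (rev ` inc_free_perms (max (m - 1) (k - 1)) n) \<le> avoid_count (hook m k) n"
    unfolding avoid_count_def by (intro card_mono) auto
  then show ?thesis by (simp add: card_image)
qed

section \<open>Permutations from a colouring of positions and a colouring of values\<close>

lemma coloured_arrangement_exists:
  fixes S :: "nat set"
  assumes "finite S" "\<And>c. card {x \<in> S. g x = c} = count_list u c"
  shows "\<exists>p. distinct p \<and> set p = S \<and> map g p = u \<and>
    sorted_wrt (\<lambda>x y. g x = g y \<longrightarrow> x > y) p \<and>
    (\<forall>i<length u. count_list (take i u) (u ! i) = card {y \<in> S. g y = u ! i \<and> p ! i < y})"
  using assms
proof (induction u arbitrary: S)
  case Nil
  have "S = {}"
  proof (rule ccontr)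
    assume "S \<noteq> {}"
    then obtain x where "x \<in> {y \<in> S. g y = g x}" by auto
    then show False using Nil(1) Nil(2)[of "g x"] by (auto simp: card_eq_0_iff)
  qed
  then show ?case by simp
next
  case (Cons c u)
  define x where "x = Max {x \<in> S. g x = c}"
  have "card {x \<in> S. g x = c} \<noteq> 0" using Cons.prems(2)[of c] by simp
  then have ne: "{x \<in> S. g x = c} \<noteq> {}" by force
  then have "x \<in> {x \<in> S. g x = c}" unfolding x_def using Cons.prems(1) by (intro Max_in) auto
  then have x: "x \<in> S" "g x = c" by auto
  have max: "y < x" if "y \<in> S" "g y = c" "y \<noteq> x" for y
  proof -
    have "y \<le> x" unfolding x_def using that Cons.prems(1) by (intro Max_ge) auto
    then show ?thesis using that by simp
  qed
  have "card {y \<in> S - {x}. g y = e} = count_list u e" for e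
  proof (cases "e = c")
    case True
    then have "{y \<in> S - {x}. g y = e} = {y \<in> S. g y = e} - {x}" by auto
    then show ?thesis using Cons.prems x True by simp
  next
    case False
    then have "{y \<in> S - {x}. g y = e} = {y \<in> S. g y = e}" using x by auto
    then show ?thesis using Cons.prems False by simp
  qed
  with Cons.IH[of "S - {x}"] Cons.prems(1) obtain p where p: "distinct p" "set p = S - {x}" "map g p = u"
    "sorted_wrt (\<lambda>x y. g x = g y \<longrightarrow> x > y) p"
    "\<And>i. i < length u \<Longrightarrow> count_list (take i u) (u ! i) = card {y \<in> S - {x}. g y = u ! i \<and> p ! i < y}"
    by auto
  have len: "length p = length u" using p(3) by auto
  have "count_list (take i (c # u)) ((c # u) ! i) = card {y \<in> S. g y = (c # u) ! i \<and> (x # p) ! i < y}"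
    if "i < length (c # u)" for i
  proof (cases i)
    case 0
    have "{y \<in> S. g y = c \<and> x < y} = {}" using max by fastforce
    then show ?thesis using 0 by (simp only: take_0 nth_Cons_0 count_list.simps card.empty)
  next
    case (Suc j)
    then have j: "j < length u" using that by simp
    then have "p ! j \<in> S - {x}" using p(2) len nth_mem[of j p] by simp
    moreover have "g (p ! j) = u ! j" using j len nth_map[of j p g] p(3) by simp
    ultimately have pj: "g (p ! j) = u ! j" "p ! j \<in> S" "p ! j \<noteq> x" by auto
    let ?A = "{y \<in> S - {x}. g y = u ! j \<and> p ! j < y}"
    \<comment> \<open>The element \<open>x\<close> put in front is the largest of colour
      \<open>c\<close>, so it adds one to the count exactly for the later entries of that
      colour.\<close>
    have "{y \<in> S. g y = u ! j \<and> p ! j < y} = (if u ! j = c then insert x ?A else ?A)"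
      using x max[of "p ! j"] pj by auto
    moreover have "card (insert x ?A) = Suc (card ?A)" using Cons.prems(1) by simp
    ultimately show ?thesis using p(5)[OF j] Suc by simp
  qed
  moreover have "sorted_wrt (\<lambda>x y. g x = g y \<longrightarrow> x > y) (x # p)" using p(2,4) x max by auto
  ultimately show ?case using p(1-3) x by (intro exI[of _ "x # p"]) auto
qed

text \<open>Entries of an increasing subsequence have pairwise distinct colours, and only
  \<open>d\<close> colours exist.\<close>

lemma desc_coloured_no_long_chain:
  assumes "sorted_wrt (\<lambda>x y. g x = g y \<longrightarrow> x > y) p" "g ` set p \<subseteq> {..<d :: nat}"
  shows "\<not> has_chain (<) (Suc d) p"
proof
  assume "has_chain (<) (Suc d) p"
  then obtain c where c: "subseq c p" "sorted_wrt (<) c" "length c = Suc d"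
    by (auto simp: has_chain_def)
  have "sorted_wrt (\<lambda>x y. g x = g y \<longrightarrow> x > y) c"
    using assms(1) c(1) subseq_order.trans unfolding sorted_wrt_iff_subseq_pair by blast
  with c(2) have "sorted_wrt (\<lambda>x y. g x \<noteq> g y) c"
    unfolding sorted_wrt_iff_subseq_pair by (meson less_asym)
  then have "distinct (map g c)" by (induction c) (auto simp: image_iff)
  then have "Suc d = card (set (map g c))" using c(3) distinct_card by fastforce
  also have "\<dots> \<le> card {..<d}" using assms(2) subseq_set[OF c(1)] by (intro card_mono) auto
  finally show False by simp
qed

lemma count_list_eq_card: "count_list xs c = card {i. i < length xs \<and> xs ! i = c}"
  by (simp add: count_list_eq_length_filter length_filter_conv_card eq_commute)

text \<open>Value \<open>y\<close> is coloured by the letter of \<open>v\<close> at index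
  \<open>n - y\<close>, so \<open>v\<close> reads the values from the top, and larger values
  correspond to earlier letters.\<close>

lemma count_list_take_from_top:
  assumes "length v = n" "x \<le> n"
  shows "card {y \<in> {1..n}. v ! (n - y) = c \<and> x < y} = count_list (take (n - x) v) c"
proof -
  have "bij_betw (\<lambda>i. n - i) {i. i < n - x \<and> v ! i = c} {y \<in> {1..n}. v ! (n - y) = c \<and> x < y}"
    by (rule bij_betw_byWitness[of _ "\<lambda>y. n - y"]) auto
  moreover have "{i. i < length (take (n - x) v) \<and> take (n - x) v ! i = c} = {i. i < n - x \<and> v ! i = c}"
    using assms by auto
  ultimately show ?thesis by (simp add: count_list_eq_card bij_betw_same_card)
qed

lemma count_list_take_less: "i < length w \<Longrightarrow> count_list (take i w) (w ! i) < count_list w (w ! i)"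
proof -
  assume "i < length w"
  from id_take_nth_drop[OF this] have "count_list w (w ! i) =
      count_list (take i w @ w ! i # drop (Suc i) w) (w ! i)" by simp
  then show ?thesis by simp
qed

section \<open>Words built from blocks of fixed content\<close>

definition words_with_content :: "nat \<Rightarrow> nat \<Rightarrow> (nat \<Rightarrow> nat) \<Rightarrow> nat list set" where
  "words_with_content d N \<kappa> =
    {w. length w = N \<and> set w \<subseteq> {..<d} \<and> (\<forall>c<d. count_list w c = \<kappa> c)}"

lemma finite_words_with_content: "finite (words_with_content d N \<kappa>)"
  by (rule finite_subset[OF _ finite_lists_length_eq[of "{..<d}" N]])
    (auto simp: words_with_content_def)

lemma length_concat_words: "set ws \<subseteq> words_with_content d N \<kappa> \<Longrightarrow> length (concat ws) = length ws * N"
  by (induction ws) (auto simp: words_with_content_def)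

lemma count_list_concat_words:
  "set ws \<subseteq> words_with_content d N \<kappa> \<Longrightarrow> c < d \<Longrightarrow> count_list (concat ws) c = length ws * \<kappa> c"
  by (induction ws) (auto simp: words_with_content_def)

lemma set_concat_words: "set ws \<subseteq> words_with_content d N \<kappa> \<Longrightarrow> set (concat ws) \<subseteq> {..<d}"
  by (induction ws) (auto simp: words_with_content_def)

text \<open>Every complete block contributes exactly \<open>\<kappa> c\<close> letters
  \<open>c\<close>. Thus the number of earlier occurrences of a letter reveals the block in which it
  stands.\<close>

lemma count_list_take_concat_words:
  assumes "set ws \<subseteq> words_with_content d N \<kappa>" "i < length ws * N" "concat ws ! i = c" "0 < N"
  shows "i div N * \<kappa> c \<le> count_list (take i (concat ws)) c \<and>
    count_list (take i (concat ws)) c < Suc (i div N) * \<kappa> c"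
  using assms
proof (induction ws arbitrary: i)
  case (Cons w ws)
  have w: "length w = N" "set w \<subseteq> {..<d}" "\<And>c. c < d \<Longrightarrow> count_list w c = \<kappa> c"
    using Cons.prems(1) by (auto simp: words_with_content_def)
  have "c < d" using set_concat_words[OF Cons.prems(1)] nth_mem[of i "concat (w # ws)"]
    length_concat_words[OF Cons.prems(1)] Cons.prems(2,3) by force
  show ?case
  proof (cases "i < N")
    case True
    then show ?thesis using count_list_take_less[of i w] Cons.prems(3) w(1) w(3)[OF \<open>c < d\<close>]
      by (auto simp: nth_append)
  next
    case False
    then have "i div N = Suc ((i - N) div N)" using Cons.prems(4) by (simp add: le_div_geq)
    moreover have "concat ws ! (i - N) = c" using False Cons.prems(3) w(1) by (simp add: nth_append)
    moreover have "i - N < length ws * N" using False Cons.prems(2) by auto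
    ultimately show ?thesis using Cons.IH[of "i - N"] Cons.prems(1,4) w(1) w(3)[OF \<open>c < d\<close>] False
      by simp
  qed
qed simp

text \<open>The filler \<open>F\<close> shifts the \<open>b\<close>-th block of letters \<open>c\<close> in the position word \<open>concat us @ F\<close>
  to the \<open>(b - c)\<close>-th block of the value word \<open>F @ concat vs\<close>: the block numbers of an entry
  reveal its colour, hence the permutation determines \<open>us\<close> and \<open>vs\<close>.\<close>

lemma card_inc_free_perms_ge:
  assumes "0 < N"
  shows "\<exists>L. \<forall>B. card (words_with_content d N \<kappa>) ^ (2 * B) \<le> card (inc_free_perms d (B * N + L))"
proof -
  let ?W = "words_with_content d N \<kappa>"
  \<comment> \<open>The filler holds as many letters \<open>c\<close> as \<open>c\<close> blocks do,
    so it delays the letter \<open>c\<close> by \<open>c\<close> blocks. Its length is independent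
    of \<open>B\<close>.\<close>
  define F where "F = concat (map (\<lambda>c. replicate (c * \<kappa> c) c) [0..<d])"
  define L where "L = length F"
  have count_replicate: "count_list (replicate a x) y = (if x = y then a else 0)" for a and x y :: nat
    by (induction a) auto
  have "count_list (concat (map (\<lambda>c. replicate (c * \<kappa> c) c) [0..<e])) c = (if c < e then c * \<kappa> c else 0)"
    for e c by (induction e) (auto simp: count_replicate)
  then have F: "count_list F c = c * \<kappa> c" if "c < d" for c using that by (simp add: F_def)
  have setF: "set F \<subseteq> {..<d}" by (auto simp: F_def)
  have "card ?W ^ (2 * B) \<le> card (inc_free_perms d (B * N + L))" for B
  proof -
    define n where "n = B * N + L"
    define X where "X = {us. set us \<subseteq> ?W \<and> length us = B}"
    \<comment> \<open>The last clause matches equal letters in order: an occurrence in the position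
      word has as many equal letters before it as its partner in the value word.\<close>
    define rel where "rel us vs p \<longleftrightarrow> distinct p \<and> set p = {1..n} \<and>
      map (\<lambda>x. (F @ concat vs) ! (n - x)) p = concat us @ F \<and>
      sorted_wrt (\<lambda>x y. (F @ concat vs) ! (n - x) = (F @ concat vs) ! (n - y) \<longrightarrow> x > y) p \<and>
      (\<forall>i<n. count_list (take i (concat us @ F)) ((concat us @ F) ! i) =
        count_list (take (n - p ! i) (F @ concat vs)) ((concat us @ F) ! i))" for us vs p
    have lens: "length (concat us @ F) = n" "length (F @ concat us) = n"
      "length (concat us) = B * N" if "us \<in> X" for us
      using length_concat_words[of us d N \<kappa>] that by (auto simp: X_def n_def L_def)
    have ex: "\<exists>p. rel us vs p" if "us \<in> X" "vs \<in> X" for us vs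
    proof -
      let ?u = "concat us @ F" and ?v = "F @ concat vs"
      have "card {x \<in> {1..n}. ?v ! (n - x) = c} = count_list ?u c" for c
      proof -
        have "{x \<in> {1..n}. ?v ! (n - x) = c} = {y \<in> {1..n}. ?v ! (n - y) = c \<and> 0 < y}" by auto
        then have "card {x \<in> {1..n}. ?v ! (n - x) = c} = count_list ?v c"
          using count_list_take_from_top[OF lens(2)[OF that(2)], of 0 c] lens(2)[OF that(2)] by simp
        also have "\<dots> = count_list ?u c"
        proof (cases "c < d")
          case True
          then show ?thesis using that count_list_concat_words[of us d N \<kappa> c]
            count_list_concat_words[of vs d N \<kappa> c] by (simp add: X_def)
        next
          case False
          then have "c \<notin> set (concat us)" "c \<notin> set (concat vs)"
            using that set_concat_words[of us d N \<kappa>] set_concat_words[of vs d N \<kappa>]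
            unfolding X_def by blast+
          then show ?thesis by (simp add: count_list_0_iff)
        qed
        finally show ?thesis .
      qed
      from coloured_arrangement_exists[OF finite_atLeastAtMost this] obtain p where
        p: "distinct p" "set p = {1..n}" "map (\<lambda>x. ?v ! (n - x)) p = ?u"
        "sorted_wrt (\<lambda>x y. ?v ! (n - x) = ?v ! (n - y) \<longrightarrow> x > y) p"
        "\<And>i. i < length ?u \<Longrightarrow> count_list (take i ?u) (?u ! i) =
          card {y \<in> {1..n}. ?v ! (n - y) = ?u ! i \<and> p ! i < y}" by blast
      have "count_list (take i ?u) (?u ! i) = count_list (take (n - p ! i) ?v) (?u ! i)" if "i < n" for i
      proof -
        have "length p = n" using p(3) lens(1)[OF \<open>us \<in> X\<close>] by (metis length_map)
        then have "p ! i \<le> n" using p(2) nth_mem[of i p] that by auto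
        then show ?thesis using p(5)[of i] lens(1)[OF \<open>us \<in> X\<close>] that
          count_list_take_from_top[OF lens(2)[OF \<open>vs \<in> X\<close>]] by simp
      qed
      with p show ?thesis unfolding rel_def by blast
    qed
    \<comment> \<open>This recovers the letter from its position index \<open>i\<close> and its
      value index \<open>j\<close>: it is read from the filler if one of them falls there, and
      otherwise is the difference of the block numbers. Neither \<open>us\<close> nor
      \<open>vs\<close> enters, which yields injectivity.\<close>
    define colour where "colour i j = (if B * N \<le> i then F ! (i - B * N)
      else if j < L then F ! j else i div N - (j - L) div N)" for i j
    have colour: "(concat us @ F) ! i = colour i (n - p ! i) \<and>
        (F @ concat vs) ! (n - p ! i) = colour i (n - p ! i)"
      if us: "us \<in> X" and vs: "vs \<in> X" and rel: "rel us vs p" and i: "i < n" for us vs p i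
    proof -
      let ?u = "concat us @ F" and ?v = "F @ concat vs"
      define c where "c = ?u ! i"
      define j where "j = n - p ! i"
      have len: "length p = n" using rel lens(1)[OF us] unfolding rel_def by (metis length_map)
      then have "p ! i \<in> {1..n}" using rel nth_mem[of i p] i by (auto simp: rel_def)
      then have j: "j < n" by (auto simp: j_def)
      have "map (\<lambda>x. ?v ! (n - x)) p ! i = ?u ! i" using rel by (simp add: rel_def)
      then have vj: "?v ! j = c" using len i by (simp add: c_def j_def)
      have cnt: "count_list (take i ?u) c = count_list (take j ?v) c"
        using rel i by (simp add: rel_def c_def j_def)
      have "c = colour i j"
      proof (cases "i < B * N \<and> L \<le> j")
        case False
        then show ?thesis using vj i lens[OF us]
          by (auto simp: c_def colour_def nth_append L_def)
      next
        case True
        have ui: "concat us ! i = c" using True lens(3)[OF us] by (simp add: c_def nth_append)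
        have vj': "concat vs ! (j - L) = c" using True vj by (simp add: nth_append L_def)
        have jl: "j - L < B * N" using j True unfolding n_def by linarith
        have "c < d" using set_concat_words[of us d N \<kappa>] us ui True lens(3)[OF us]
          nth_mem[of i "concat us"] by (auto simp: X_def)
        have u: "i div N * \<kappa> c \<le> count_list (take i ?u) c"
          "count_list (take i ?u) c < Suc (i div N) * \<kappa> c"
          using count_list_take_concat_words[of us d N \<kappa> i c] us ui True assms lens(3)[OF us]
          by (auto simp: X_def)
        have "(j - L) div N * \<kappa> c \<le> count_list (take (j - L) (concat vs)) c"
          "count_list (take (j - L) (concat vs)) c < Suc ((j - L) div N) * \<kappa> c"
          using count_list_take_concat_words[of vs d N \<kappa> "j - L" c] vs vj' jl assms
          by (auto simp: X_def)
        moreover have "count_list (take j ?v) c = c * \<kappa> c + count_list (take (j - L) (concat vs)) c"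
          using True F[OF \<open>c < d\<close>] by (simp add: L_def)
        ultimately have v: "(c + (j - L) div N) * \<kappa> c \<le> count_list (take j ?v) c"
          "count_list (take j ?v) c < Suc (c + (j - L) div N) * \<kappa> c"
          by (simp_all add: add_mult_distrib)
        \<comment> \<open>The common count lies in two half-open intervals between consecutive
          multiples of \<open>\<kappa> c\<close>, so the two block numbers agree.\<close>
        have "i div N * \<kappa> c < Suc (c + (j - L) div N) * \<kappa> c"
          "(c + (j - L) div N) * \<kappa> c < Suc (i div N) * \<kappa> c" using u v cnt by linarith+
        then have "i div N < Suc (c + (j - L) div N)" "c + (j - L) div N < Suc (i div N)"
          using mult_less_cancel2 by blast+
        then have "i div N = c + (j - L) div N" by simp
        then show ?thesis using True by (simp add: colour_def)
      qed
      then show ?thesis using vj by (simp add: c_def j_def)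
    qed
    define \<Psi> where "\<Psi> z = (SOME p. rel (fst z) (snd z) p)" for z
    have \<Psi>: "rel us vs (\<Psi> (us, vs))" if "us \<in> X" "vs \<in> X" for us vs
      unfolding \<Psi>_def using someI_ex[OF ex[OF that]] by simp
    have "inj_on \<Psi> (X \<times> X)"
    proof (rule inj_onI)
      fix z z' assume "z \<in> X \<times> X" "z' \<in> X \<times> X" and eq: "\<Psi> z = \<Psi> z'"
      then obtain us vs us' vs' where z: "z = (us, vs)" "z' = (us', vs')"
        "us \<in> X" "vs \<in> X" "us' \<in> X" "vs' \<in> X" by auto
      define p where "p = \<Psi> z"
      have rel: "rel us vs p" "rel us' vs' p"
        using \<Psi>[OF z(3,4)] \<Psi>[OF z(5,6)] eq z(1,2) by (simp_all add: p_def)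
      have same: "(concat us @ F) ! i = (concat us' @ F) ! i"
        "(F @ concat vs) ! (n - p ! i) = (F @ concat vs') ! (n - p ! i)" if "i < n" for i
        using colour[OF z(3,4) rel(1) that] colour[OF z(5,6) rel(2) that] by auto
      have "concat us @ F = concat us' @ F"
        using lens(1)[OF z(3)] lens(1)[OF z(5)] same(1) by (intro nth_equalityI) auto
      moreover have "F @ concat vs = F @ concat vs'"
      proof (rule nth_equalityI)
        fix j assume "j < length (F @ concat vs)"
        then have j: "j < n" using lens(2)[OF z(4)] by simp
        then have "n - j \<in> set p" using rel(1) by (auto simp: rel_def)
        then obtain i where i: "i < length p" "p ! i = n - j" by (auto simp: in_set_conv_nth)
        have "length p = n" using rel(1) lens(1)[OF z(3)] unfolding rel_def by (metis length_map)
        then show "(F @ concat vs) ! j = (F @ concat vs') ! j" using same(2)[of i] i j by simp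
      qed (use lens(2)[OF z(4)] lens(2)[OF z(6)] in simp)
      moreover have "ws = ws'" if "ws \<in> X" "ws' \<in> X" "concat ws = concat ws'" for ws ws'
      proof (rule concat_injective[OF that(3)])
        show "length ws = length ws'" using that by (simp add: X_def)
        have "length w = N" if "w \<in> set ws \<union> set ws'" for w
          using that \<open>ws \<in> X\<close> \<open>ws' \<in> X\<close> by (auto simp: X_def words_with_content_def)
        then show "\<forall>(x, y)\<in>set (zip ws ws'). length x = length y"
          by (auto dest: set_zip_leftD set_zip_rightD)
      qed
      ultimately show "z = z'" using z by simp
    qed
    moreover have "\<Psi> ` (X \<times> X) \<subseteq> inc_free_perms d n"
    proof
      fix p assume "p \<in> \<Psi> ` (X \<times> X)"
      then obtain us vs where z: "us \<in> X" "vs \<in> X" "rel us vs p" using \<Psi> by auto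
      let ?g = "\<lambda>x. (F @ concat vs) ! (n - x)"
      have "?g ` set p = set (concat us @ F)" using z(3) unfolding rel_def by (metis list.set_map)
      also have "\<dots> \<subseteq> {..<d}" using z(1) set_concat_words[of us d N \<kappa>] setF by (auto simp: X_def)
      finally have "\<not> has_chain (<) (Suc d) p"
        using z(3) desc_coloured_no_long_chain[of ?g p d] unfolding rel_def by blast
      then show "p \<in> inc_free_perms d n"
        using z(3) by (simp add: inc_free_perms_def permutations_of_set_def rel_def)
    qed
    moreover have "finite (inc_free_perms d n)" by (simp add: inc_free_perms_def)
    ultimately have "card (X \<times> X) \<le> card (inc_free_perms d n)" by (rule card_inj_on_le)
    moreover have "card X = card ?W ^ B"
      unfolding X_def using card_lists_length_eq[OF finite_words_with_content] .
    ultimately show ?thesis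
      by (simp add: card_cartesian_product n_def mult_2 power_add)
  qed
  then show ?thesis by blast
qed

text \<open>Pigeonhole: the \<open>d ^ N\<close> words have at most \<open>(N + 1) ^ d\<close>
  contents, as each of the \<open>d\<close> multiplicities is at most \<open>N\<close>.\<close>

lemma popular_content_exists:
  "\<exists>\<kappa>. d ^ N \<le> card (words_with_content d N \<kappa>) * (N + 1) ^ d"
proof (rule ccontr)
  assume "\<not> ?thesis"
  then have small: "card (words_with_content d N \<kappa>) * (N + 1) ^ d < d ^ N" for \<kappa> by (simp add: not_le)
  define \<Omega> where "\<Omega> = {w. set w \<subseteq> {..<d} \<and> length w = N}"
  define Y where "Y = {l. set l \<subseteq> {..N} \<and> length l = d}"
  have Y: "finite Y" "card Y = (N + 1) ^ d"
    unfolding Y_def using finite_lists_length_eq[of "{..N}" d] card_lists_length_eq[of "{..N}" d] by auto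
  then have "Y \<noteq> {}" by auto
  have "\<Omega> \<subseteq> (\<Union>y\<in>Y. words_with_content d N (\<lambda>c. y ! c))"
  proof
    fix w assume w: "w \<in> \<Omega>"
    have "map (count_list w) [0..<d] \<in> Y" using w count_le_length[of w] by (auto simp: Y_def \<Omega>_def)
    moreover have "w \<in> words_with_content d N (\<lambda>c. map (count_list w) [0..<d] ! c)"
      using w by (auto simp: words_with_content_def \<Omega>_def)
    ultimately show "w \<in> (\<Union>y\<in>Y. words_with_content d N (\<lambda>c. y ! c))" by blast
  qed
  then have "card \<Omega> \<le> card (\<Union>y\<in>Y. words_with_content d N (\<lambda>c. y ! c))"
    using Y(1) finite_words_with_content by (intro card_mono) auto
  also have "\<dots> \<le> (\<Sum>y\<in>Y. card (words_with_content d N (\<lambda>c. y ! c)))"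
    using Y(1) by (rule card_UN_le)
  finally have "d ^ N \<le> (\<Sum>y\<in>Y. card (words_with_content d N (\<lambda>c. y ! c)))"
    by (simp add: \<Omega>_def card_lists_length_eq)
  then have "d ^ N * card Y \<le> (\<Sum>y\<in>Y. card (words_with_content d N (\<lambda>c. y ! c)) * (N + 1) ^ d)"
    by (simp add: Y(2) flip: sum_distrib_right)
  also have "\<dots> < (\<Sum>y\<in>Y. d ^ N)"
    by (rule sum_strict_mono[OF Y(1) \<open>Y \<noteq> {}\<close> small])
  finally show False by simp
qed

section \<open>The limit\<close>

text \<open>A single entry is already a crossing of two chains of length one, and
  \<open>0 < n\<close> supplies such an entry.\<close>

lemma avoid_count_hook_1_1:
  assumes "0 < n"
  shows "avoid_count (hook 1 1) n = 0"
proof -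
  have "\<not> shape_avoiding (hook 1 1) p" if "p \<in> permutations_of_set {1..n}" for p
    by (rule crossing_chains_not_shape_avoiding[of p 1 1 "{1}" "{1}" 1])
      (use that assms in \<open>auto simp: permutations_of_set_def\<close>)
  then show ?thesis by (simp add: avoid_count_def)
qed

text \<open>Fix a block length \<open>N\<close> for which the number \<open>M\<close> of blocks of a
  popular content satisfies \<open>M powr (1 / N) > a\<close>. For large \<open>n\<close>, about
  \<open>n / N\<close> blocks fit into each of the two words, and the root tends to
  \<open>M powr (1 / N)\<close>.\<close>

lemma eventually_root_card_inc_free_perms_gt:
  assumes "0 < d" "a < real d"
  shows "\<forall>\<^sub>F n in sequentially. a < real (card (inc_free_perms d n)) powr (1 / (2 * real n))"
proof -
  have "(\<lambda>N. real d / (real N + 1) powr (real d / real N)) \<longlonglongrightarrow> real d"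
    by real_asymp
  then have "\<forall>\<^sub>F N in sequentially. a < real d / (real N + 1) powr (real d / real N)"
    using assms(2) by (rule order_tendstoD)
  then have "\<forall>\<^sub>F N in sequentially. a < real d / (real N + 1) powr (real d / real N) \<and> 0 < N"
    by (intro eventually_conj eventually_gt_at_top)
  then obtain N where N: "a < real d / (real N + 1) powr (real d / real N)" "0 < N"
    by (auto simp: eventually_sequentially)
  obtain \<kappa> where \<kappa>: "d ^ N \<le> card (words_with_content d N \<kappa>) * (N + 1) ^ d"
    using popular_content_exists by blast
  define M where "M = card (words_with_content d N \<kappa>)"
  obtain L where L: "\<And>B. M ^ (2 * B) \<le> card (inc_free_perms d (B * N + L))"
    using card_inc_free_perms_ge[OF N(2), of d \<kappa>] unfolding M_def by blast
  \<comment> \<open>This makes \<open>powr\<close> with base \<open>M\<close> monotone in the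
    exponent.\<close>
  have M: "1 \<le> M" using \<kappa> assms(1) by (cases "M = 0") (auto simp: M_def)
  have "real d / (real N + 1) powr (real d / real N) = (real d ^ N / (real N + 1) ^ d) powr (1 / real N)"
  proof -
    have "(real d ^ N) powr (1 / real N) = real d"
      using N(2) assms(1) by (simp add: powr_powr flip: powr_realpow)
    moreover have "((real N + 1) ^ d) powr (1 / real N) = (real N + 1) powr (real d / real N)"
      by (simp add: powr_powr flip: powr_realpow)
    ultimately show ?thesis by (simp add: powr_divide)
  qed
  also have "\<dots> \<le> real M powr (1 / real N)"
  proof (rule powr_mono2)
    have "real (d ^ N) \<le> real (M * (N + 1) ^ d)" using \<kappa> unfolding M_def of_nat_le_iff .
    then have "real d ^ N \<le> real M * (real N + 1) ^ d" by (simp add: add.commute)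
    then show "real d ^ N / (real N + 1) ^ d \<le> real M" by (simp add: divide_le_eq)
  qed auto
  finally have aM: "a < real M powr (1 / real N)" using N(1) by simp
  \<comment> \<open>The exponent bounds \<open>B / n\<close> from below for
    \<open>B = (n - L) div N\<close>; the term \<open>1 / n\<close> pays for rounding down.\<close>
  have "(\<lambda>n. (1 - real L / real n) / real N - 1 / real n) \<longlonglongrightarrow> 1 / real N"
    using N(2) by real_asymp (simp add: field_simps)
  then have "(\<lambda>n. real M powr ((1 - real L / real n) / real N - 1 / real n)) \<longlonglongrightarrow> real M powr (1 / real N)"
    using M by (intro tendsto_intros) auto
  then have "\<forall>\<^sub>F n in sequentially. a < real M powr ((1 - real L / real n) / real N - 1 / real n)"
    using aM by (rule order_tendstoD)
  then show ?thesis
    using eventually_gt_at_top[of L]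
  proof eventually_elim
    case (elim n)
    define B where "B = (n - L) div N"
    have "n - L = B * N + (n - L) mod N" by (simp add: B_def)
    also have "\<dots> \<le> B * N + N" using N(2) by (simp add: less_imp_le)
    finally have "real (n - L) \<le> real (B * N + N)" unfolding of_nat_le_iff .
    then have "real n - real L \<le> (real B + 1) * real N"
      using elim(2) by (simp add: of_nat_diff algebra_simps)
    then have "(real n - real L) / real N - 1 \<le> real B" using N(2) by (simp add: field_simps)
    then have "((real n - real L) / real N - 1) / real n \<le> real B / real n"
      by (intro divide_right_mono) auto
    moreover have "(1 - real L / real n) / real N - 1 / real n = ((real n - real L) / real N - 1) / real n"
      using elim(2) N(2) by (simp add: field_simps)
    ultimately have "(1 - real L / real n) / real N - 1 / real n \<le> real B / real n" by simp
    then have "real M powr ((1 - real L / real n) / real N - 1 / real n) \<le> real M powr (real B / real n)"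
      using M by (intro powr_mono) auto
    also have "\<dots> = (real M ^ (2 * B)) powr (1 / (2 * real n))"
      using M by (simp add: powr_powr flip: powr_realpow)
    also have "\<dots> \<le> real (card (inc_free_perms d n)) powr (1 / (2 * real n))"
    proof (rule powr_mono2)
      have "B * N \<le> n - L" unfolding B_def by (rule div_times_less_eq_dividend)
      then have "B * N + L \<le> n" using elim(2) by simp
      then have "M ^ (2 * B) \<le> card (inc_free_perms d n)"
        using L card_inc_free_perms_mono[OF assms(1)] le_trans by blast
      then show "real M ^ (2 * B) \<le> real (card (inc_free_perms d n))"
        by (simp flip: of_nat_power)
    qed auto
    finally show ?case using elim(1) by simp
  qed
qed

theorem corollary5:
  fixes m k :: nat
  assumes "m > 0" and "k > 0"
  shows "(\<lambda>n. real (avoid_count (hook m k) n) powr (1 / (2 * real n)))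
    \<longlonglongrightarrow> max (real m - 1) (real k - 1)"
proof -
  define D where "D = max (m - 1) (k - 1)"
  have D: "max (real m - 1) (real k - 1) = real D"
    using assms by (cases "m \<le> k") (auto simp: D_def of_nat_diff max_def)
  show ?thesis
  proof (cases "D = 0")
    case True
    \<comment> \<open>The general bounds require a positive number of colours, so this degenerate
      case is settled by the vanishing of the count for positive \<open>n\<close>.\<close>
    then have "m = 1" "k = 1" using assms by (auto simp: D_def)
    have "\<forall>\<^sub>F n in sequentially. real (avoid_count (hook m k) n) powr (1 / (2 * real n)) = 0"
      using eventually_gt_at_top[of 0]
      by eventually_elim (simp add: \<open>m = 1\<close> \<open>k = 1\<close> avoid_count_hook_1_1[unfolded One_nat_def])
    then show ?thesis unfolding D True by (simp add: tendsto_eventually)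
  next
    case False
    define K where "K = (m + k) * (m + k)"
    \<comment> \<open>After taking the root, the polynomial factor becomes
      \<open>(n + 1) powr (K / n)\<close>, which tends to \<open>1\<close>, and so does the root of
      the factor \<open>2\<close>.\<close>
    have upper: "real (avoid_count (hook m k) n) powr (1 / (2 * real n)) \<le>
        2 powr (1 / (2 * real n)) * (real D * (real n + 1) powr (real K / real n))" if "0 < n" for n
    proof -
      have "real (avoid_count (hook m k) n) \<le> real (2 * (D ^ n * (n + 1) ^ K)\<^sup>2)"
        using avoid_count_le[OF assms D_def _ K_def] False unfolding of_nat_le_iff by simp
      also have "\<dots> = 2 * (real D ^ n * (real n + 1) ^ K)\<^sup>2" by (simp add: add.commute)
      finally have "real (avoid_count (hook m k) n) powr (1 / (2 * real n)) \<le>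
          (2 * (real D ^ n * (real n + 1) ^ K)\<^sup>2) powr (1 / (2 * real n))"
        by (intro powr_mono2) auto
      also have "\<dots> = 2 powr (1 / (2 * real n)) * ((real D ^ n * (real n + 1) ^ K)\<^sup>2) powr (1 / (2 * real n))"
        by (simp add: powr_mult)
      also have "((real D ^ n * (real n + 1) ^ K)\<^sup>2) powr (1 / (2 * real n)) =
          (real D ^ n * (real n + 1) ^ K) powr (1 / real n)"
        using False by (simp add: powr_powr flip: powr_numeral)
      also have "\<dots> = (real D ^ n) powr (1 / real n) * ((real n + 1) ^ K) powr (1 / real n)"
        by (simp add: powr_mult)
      also have "(real D ^ n) powr (1 / real n) = real D"
        using that False by (simp add: powr_powr flip: powr_realpow)
      also have "((real n + 1) ^ K) powr (1 / real n) = (real n + 1) powr (real K / real n)"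
        by (simp add: powr_powr flip: powr_realpow)
      finally show ?thesis .
    qed
    have "(\<lambda>n. 2 powr (1 / (2 * real n)) * (real D * (real n + 1) powr (real K / real n)))
        \<longlonglongrightarrow> real D"
      by real_asymp
    note lim = order_tendstoD(2)[OF this]
    show ?thesis unfolding D
    proof (rule order_tendstoI)
      fix a assume "a < real D"
      with eventually_root_card_inc_free_perms_gt[of D a] False
      have "\<forall>\<^sub>F n in sequentially. a < real (card (inc_free_perms D n)) powr (1 / (2 * real n))"
        by simp
      then show "\<forall>\<^sub>F n in sequentially. a < real (avoid_count (hook m k) n) powr (1 / (2 * real n))"
      proof eventually_elim
        case (elim n)
        also have "real (card (inc_free_perms D n)) powr (1 / (2 * real n)) \<le>
            real (avoid_count (hook m k) n) powr (1 / (2 * real n))"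
          using card_inc_free_perms_le_avoid_count[OF assms, of n] unfolding D_def
          by (intro powr_mono2) auto
        finally show ?case .
      qed
    next
      fix a assume "real D < a"
      from lim[OF this] eventually_gt_at_top[of 0]
      show "\<forall>\<^sub>F n in sequentially. real (avoid_count (hook m k) n) powr (1 / (2 * real n)) < a"
      proof eventually_elim
        case (elim n)
        then show ?case using upper[of n] by simp
      qed
    qed
  qed
qed

end
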